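(* Let $D$ be a Jordan domain in $\mathbb C$ with rectifiable boundary, and let $\lambda:\partial D\to\mathbb C$ with $|\lambda(\zeta)|=1$ for all $\zeta$, and $\varphi:\partial D\to\mathbb R$ be functions measurable with respect to the natural parameter (arc length) on $\partial D$. Let $S$ be the set of all analytic functions $f:D\to\mathbb C$ such that for almost every $\zeta\in\partial D$ with respect to arc length, $\mathrm{Re}\,\{\overline{\lambda(\zeta)}\cdot f(z)\}\to\varphi(\zeta)$ as $z\to\zeta$ along any nontangential path in $D$ ending at $\zeta$. Then $S$ has infinite dimension, i.e. the real linear span of the differences $f_1-f_2$, $f_1,f_2\in S$, is infinite-dimensional.
   Context: A rectifiable Jordan curve has a tangent at almost every point with respect to arc length. At a boundary point $\zeta$ where $\partial D$ has a tangent, a nontangential path is a path in $D$ tending to $\zeta$ that, near $\zeta$, stays inside some closed angular sector with vertex $\zeta$ whose sides make positive angles with the tangent line. The set $S$ is a real affine space; its dimension is that of the real linear space spanned by differences of its elements. *)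

theory Defs
  imports "HOL-Analysis.Analysis"
begin

definition chord_sums :: "(real \<Rightarrow> complex) \<Rightarrow> real \<Rightarrow> real \<Rightarrow> real set" where
  "chord_sums g a b =
     {(\<Sum>i<n. cmod (g (x (Suc i)) - g (x i))) | n x.
        x 0 = a \<and> x n = b \<and> (\<forall>i<n. x i \<le> x (Suc i))}"

definition arclength_parametrized :: "(real \<Rightarrow> complex) \<Rightarrow> real \<Rightarrow> bool" where
  "arclength_parametrized g L \<longleftrightarrow> L > 0 \<and>
     (\<forall>a b. 0 \<le> a \<and> a \<le> b \<and> b \<le> 1 \<longrightarrow>
        bdd_above (chord_sums g a b) \<and> Sup (chord_sums g a b) = L * (b - a))"

definition sector :: "complex \<Rightarrow> complex \<Rightarrow> real \<Rightarrow> real \<Rightarrow> complex set" where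
  "sector \<zeta> v a b = {\<zeta> + complex_of_real r * cis \<theta> * v | r \<theta>. 0 \<le> r \<and> a \<le> \<theta> \<and> \<theta> \<le> b}"

text \<open>A nontangential path in D ending at \<zeta>, where v \<noteq> 0 spans the tangent line at \<zeta>:
  a continuous path in D tending to \<zeta> that eventually stays in a closed sector
  whose sides make positive angles with the tangent line.\<close>
definition nontangential_path ::
  "complex set \<Rightarrow> complex \<Rightarrow> complex \<Rightarrow> (real \<Rightarrow> complex) \<Rightarrow> bool" where
  "nontangential_path D \<zeta> v p \<longleftrightarrow>
     continuous_on {0..<1} p \<and> p ` {0..<1} \<subseteq> D \<and> (p \<longlongrightarrow> \<zeta>) (at_left 1) \<and>
     (\<exists>a b. ((0 < a \<and> a \<le> b \<and> b < pi) \<or> (pi < a \<and> a \<le> b \<and> b < 2 * pi)) \<and>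
            eventually (\<lambda>s. p s \<in> sector \<zeta> v a b) (at_left 1))"

text \<open>The class S: analytic f on D = inside of the curve g, such that for almost every
  boundary point g t (arc length \<leftrightarrow> Lebesgue measure in t) at which the boundary has a
  tangent (direction v = g'(t) \<noteq> 0), Re (conj(lam) * f) tends to phi along every
  nontangential path.\<close>
definition bv_class ::
  "complex set \<Rightarrow> (real \<Rightarrow> complex) \<Rightarrow> (complex \<Rightarrow> complex) \<Rightarrow> (complex \<Rightarrow> real)
     \<Rightarrow> (complex \<Rightarrow> complex) set" where
  "bv_class D g lam phi =
     {f. f holomorphic_on D \<and>
         (AE t in lebesgue_on {0..1}.
            \<forall>v. (g has_vector_derivative v) (at t) \<and> v \<noteq> 0 \<longrightarrow>
              (\<forall>p. nontangential_path D (g t) v p \<longrightarrow>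
                 ((\<lambda>s. Re (cnj (lam (g t)) * f (p s))) \<longlongrightarrow> phi (g t)) (at_left 1)))}"

text \<open>The real linear span of the differences f1 - f2 (f1, f2 \<in> S), viewed as functions
  on D, is infinite-dimensional: for every n it contains n real-linearly independent
  elements (which may be taken to be differences themselves).\<close>
definition infinite_dim_differences :: "complex set \<Rightarrow> (complex \<Rightarrow> complex) set \<Rightarrow> bool" where
  "infinite_dim_differences D S \<longleftrightarrow>
     (\<forall>n::nat. \<exists>h :: nat \<Rightarrow> complex \<Rightarrow> complex.
        (\<forall>i<n. \<exists>f1\<in>S. \<exists>f2\<in>S. \<forall>z\<in>D. h i z = f1 z - f2 z) \<and>
        (\<forall>c :: nat \<Rightarrow> real. (\<forall>z\<in>D. (\<Sum>i<n. complex_of_real (c i) * h i z) = 0)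
             \<longrightarrow> (\<forall>i<n. c i = 0)))"

end

theory Submission
  imports Defs "HOL-Complex_Analysis.Complex_Analysis"
begin

text \<open>Conformal maps are avoided. A correction step is local: for measurable data r one takes a finite
  sum f of small dipoles along the curve, with poles outside D and scaled to the mesh 1/N of a
  partition, such that outside a set of parameters of small measure the residual
  \<open>r - Re (cnj \<lambda> f)\<close> is at most \<open>39/40 \<bar>r\<bar>\<close> plus a small error, f is controlled by the local size of r
  in nontangential regions, and f is tiny on a given compact subset of D. Only differentiability of
  the curve, Lusin's theorem and Egorov's theorem enter, together with the fact that the two sides
  of the curve at a point with a tangent do not both lie in D.

  Iterating the step and summing solves the boundary value problem with a function that is small on
  a prescribed compact set (Borel-Cantelli takes care of the exceptional sets). Applied to the data
  changed by a polynomial, this shows that the class is dense in the entire functions, uniformly on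
  compact subsets of D, so differences of its members interpolate Lagrange bases approximately.\<close>

section \<open>Loops and their tangents\<close>

text \<open>The obstacle is to exchange the infinite sum of corrections with a nontangential limit,
  although every correction has poles on the curve. Hence the bound for a correction near a boundary
  point is in terms of the residual at that very point, divided by the tolerance
  \<open>\<kappa>\<close> that limits the measure of the exceptional set. Two rates must fit
  together: the tolerances decay like \<open>q ^ n\<close>, which makes the exceptional sets
  summable, and the residuals must decay like \<open>q ^ (2 * n)\<close>, so that the quotients are
  still summable. This asks for \<open>q\<^sup>2\<close> above the contraction factor, and is
  possible because that factor does not depend on the tolerance. The factor 39/40 arises as follows.
  At a good parameter the real part of a correction is, up to a small error, the residual times a
  sum of Poisson kernels over 20. These sums lie between 1/2 and 20: at least one fortieth of the
  residual is removed, and never more than all of it. The absolute bound 20 exists because the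
  Poisson kernel, unlike the dipole itself, stays bounded near the pole.\<close>

lemma arclength_parametrized_lipschitz:
  assumes "arclength_parametrized g L" and st: "s \<in> {0..1}" "t \<in> {0..1}"
  shows "cmod (g s - g t) \<le> L * \<bar>s - t\<bar>"
proof -
  have *: "cmod (g b - g a) \<le> L * (b - a)" if "0 \<le> a" "a \<le> b" "b \<le> 1" for a b
  proof -
    have "cmod (g b - g a) \<in> chord_sums g a b"
      unfolding chord_sums_def
      using that by (intro CollectI exI[of _ "1::nat"] exI[of _ "\<lambda>i::nat. if i = 0 then a else b"]) auto
    with assms(1) that show ?thesis
      unfolding arclength_parametrized_def by (metis cSup_upper)
  qed
  show ?thesis
    using *[of s t] *[of t s] st by (cases "s \<le> t") (auto simp: norm_minus_commute)
qed

text \<open>Either \<open>w\<close> is at least half as long as \<open>x\<close> and its imaginary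
  part alone keeps it off the axis, or it is so short that the triangle inequality suffices. After
  division by the tangent vector the real axis stands for the tangent line, with
  \<open>x = s - t\<close>.\<close>

lemma dist_real_axis_cone:
  fixes w :: complex
  assumes "\<mu> * cmod w \<le> \<bar>Im w\<bar>" "0 < \<mu>" "\<mu> \<le> 1"
  shows "\<mu> / 2 * \<bar>x\<bar> \<le> cmod (w - of_real x)"
proof (cases "cmod w \<ge> \<bar>x\<bar> / 2")
  case True
  have "\<mu> * (\<bar>x\<bar> / 2) \<le> \<mu> * cmod w"
    using True assms by (intro mult_left_mono) auto
  also have "\<dots> \<le> \<bar>Im (w - of_real x)\<bar>" using assms by simp
  also have "\<dots> \<le> cmod (w - of_real x)" by (rule abs_Im_le_cmod)
  finally show ?thesis by simp
next
  case False
  have "\<mu> / 2 * \<bar>x\<bar> \<le> 1 / 2 * \<bar>x\<bar>"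
    using assms by (intro mult_right_mono) auto
  moreover have "cmod (of_real x) \<le> cmod (w - of_real x) + cmod w"
    by (metis norm_minus_commute norm_triangle_sub add.commute)
  ultimately show ?thesis using False by simp
qed

text \<open>Serves in \<open>one_side_outside\<close>, where connectedness of a half cone decides
  its side as a whole.\<close>

lemma convex_upper_cone: "convex {w. k * cmod w < Im w}" if "0 \<le> k"
proof (rule convexI)
  fix x y :: complex and u v :: real
  assume xy: "x \<in> {w. k * cmod w < Im w}" "y \<in> {w. k * cmod w < Im w}"
    and uv: "0 \<le> u" "0 \<le> v" "u + v = 1"
  have "k * cmod (u *\<^sub>R x + v *\<^sub>R y) \<le> k * (u * cmod x + v * cmod y)"
    using norm_triangle_ineq[of "u *\<^sub>R x" "v *\<^sub>R y"] uv that by (intro mult_left_mono) auto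
  also have "\<dots> = u * (k * cmod x) + v * (k * cmod y)" by (simp add: algebra_simps)
  also have "\<dots> < u * Im x + v * Im y"
  proof (cases "u = 0")
    case True then show ?thesis using xy uv by simp
  next
    case False
    then have "u * (k * cmod x) < u * Im x" "v * (k * cmod y) \<le> v * Im y"
      using xy uv by (auto intro: mult_left_mono)
    then show ?thesis by linarith
  qed
  finally show "u *\<^sub>R x + v *\<^sub>R y \<in> {w. k * cmod w < Im w}" by simp
qed

text \<open>The compact interval of angles avoids the zeros of sine, so the minimum of
  \<open>\<bar>sin\<bar>\<close> on it is positive and can serve as \<open>\<mu>\<close>. The
  resulting inequality is scale invariant and treats both sides of the tangent alike.\<close>

lemma sector_nontangential:
  assumes ab: "(0 < a \<and> a \<le> b \<and> b < pi) \<or> (pi < a \<and> a \<le> b \<and> b < 2 * pi)" and v: "v \<noteq> 0"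
  obtains \<mu> where "0 < \<mu>"
    "\<And>z. z \<in> sector \<zeta> v a b \<Longrightarrow> \<mu> * cmod ((z - \<zeta>) / v) \<le> \<bar>Im ((z - \<zeta>) / v)\<bar>"
proof -
  have "a \<le> b" using ab by auto
  moreover have "continuous_on {a..b} (\<lambda>x. \<bar>sin x\<bar>)" by (intro continuous_intros)
  ultimately obtain x0 where x0: "x0 \<in> {a..b}" "\<And>x. x \<in> {a..b} \<Longrightarrow> \<bar>sin x0\<bar> \<le> \<bar>sin x\<bar>"
    using continuous_attains_inf[of "{a..b}" "\<lambda>x. \<bar>sin x\<bar>"] by auto
  have "sin x0 \<noteq> 0"
    using ab
  proof
    assume "0 < a \<and> a \<le> b \<and> b < pi"
    then show ?thesis using x0(1) sin_gt_zero[of x0] by auto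
  next
    assume "pi < a \<and> a \<le> b \<and> b < 2 * pi"
    then show ?thesis using x0(1) sin_lt_zero[of x0] by auto
  qed
  show thesis
  proof (rule that[of "\<bar>sin x0\<bar>"])
    show "0 < \<bar>sin x0\<bar>" using \<open>sin x0 \<noteq> 0\<close> by simp
    fix z assume "z \<in> sector \<zeta> v a b"
    then obtain \<rho> \<theta> where z: "z = \<zeta> + complex_of_real \<rho> * cis \<theta> * v" "0 \<le> \<rho>" "\<theta> \<in> {a..b}"
      by (auto simp: sector_def)
    have eq: "(z - \<zeta>) / v = complex_of_real \<rho> * cis \<theta>" using z(1) v by simp
    have "\<bar>sin x0\<bar> * \<rho> \<le> \<bar>sin \<theta>\<bar> * \<rho>" using x0(2)[OF z(3)] z(2) by (intro mult_right_mono) auto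
    then show "\<bar>sin x0\<bar> * cmod ((z - \<zeta>) / v) \<le> \<bar>Im ((z - \<zeta>) / v)\<bar>"
      unfolding eq using z(2) by (simp add: norm_mult abs_mult mult.commute)
  qed
qed

text \<open>The arc-length parametrisation enters the rest of the proof only through this Lipschitz
  bound; a nonzero derivative is a pointwise condition, see \<open>regular\<close>.\<close>

locale lipschitz_loop =
  fixes g :: "real \<Rightarrow> complex" and L :: real
  assumes simple: "simple_path g" and loop: "pathfinish g = pathstart g" and L_pos: "0 < L"
    and lip: "\<And>s t. s \<in> {0..1} \<Longrightarrow> t \<in> {0..1} \<Longrightarrow> cmod (g s - g t) \<le> L * \<bar>s - t\<bar>"
begin

abbreviation D :: "complex set" where "D \<equiv> inside (path_image g)"

text \<open>The endpoints, a null set, are left out because \<open>g 0 = g 1\<close> spoils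
  injectivity there and a two-sided derivative would depend on values of \<open>g\<close> outside
  the unit interval.\<close>

definition regular :: "real \<Rightarrow> complex \<Rightarrow> bool" where
  "regular t v \<longleftrightarrow> t \<in> {0<..<1} \<and> v \<noteq> 0 \<and> (g has_vector_derivative v) (at t)"

lemma regularD: "regular t v \<Longrightarrow> 0 < t" "regular t v \<Longrightarrow> t < 1" "regular t v \<Longrightarrow> v \<noteq> 0"
  by (auto simp: regular_def)

lemma open_D: "open D" and connected_D: "connected D" and D_nonempty: "D \<noteq> {}"
  using Jordan_inside_outside[OF simple loop] by auto

lemma D_disjoint: "D \<inter> path_image g = {}"
  using inside_no_overlap by auto

lemma path_g: "path g" and continuous_g: "continuous_on {0..1} g"
  using simple by (auto simp: simple_path_def path_def)

lemma in_path_image: "s \<in> {0..1} \<Longrightarrow> g s \<in> path_image g"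
  by (auto simp: path_image_def)

lemma interior_param_unique:
  assumes "s \<in> {0..1}" "0 < t" "t < 1" "g s = g t"
  shows "s = t"
  using simple assms unfolding simple_path_def loop_free_def by force

section \<open>First-order behaviour at a tangent, and the two sides of the curve\<close>

lemma regular_approx:
  assumes "regular t v" "0 < e"
  obtains \<rho> where "0 < \<rho>"
    "\<And>s. \<bar>s - t\<bar> < \<rho> \<Longrightarrow> cmod (g s - g t - complex_of_real (s - t) * v) \<le> e * \<bar>s - t\<bar>"
proof -
  have "(g has_derivative (\<lambda>x. x *\<^sub>R v)) (at t)"
    using assms(1) by (auto simp: regular_def has_vector_derivative_def)
  with assms(2) obtain \<rho> where "0 < \<rho>"
    "\<forall>s. norm (s - t) < \<rho> \<longrightarrow> norm (g s - g t - (s - t) *\<^sub>R v) \<le> e * norm (s - t)"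
    unfolding has_derivative_at_alt by blast
  with that[of \<rho>] show thesis
    by (simp add: scaleR_conv_of_real)
qed

text \<open>For \<open>s\<close> near \<open>t\<close> the curve follows its tangent line, from
  which the cone keeps \<open>z\<close> away at a rate proportional to
  \<open>\<bar>s - t\<bar>\<close>; the rest of the curve has positive distance from
  \<open>g t\<close>. The linear rate is what later bounds the dipole sums uniformly in the
  region.\<close>

lemma nontangential_separation:
  assumes reg: "regular t v" and mu: "0 < \<mu>"
  obtains c r where "0 < c" "0 < r"
    "\<And>z s. \<lbrakk>cmod (z - g t) < r; \<mu> * cmod ((z - g t) / v) \<le> \<bar>Im ((z - g t) / v)\<bar>; s \<in> {0..1}\<rbrakk>
      \<Longrightarrow> c * \<bar>s - t\<bar> \<le> cmod (z - g s)"
proof -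
  note t = regularD[OF reg]
  define m where "m = min \<mu> 1"
  have m: "0 < m" "m \<le> 1" "m \<le> \<mu>" using mu by (auto simp: m_def)
  obtain \<rho> where \<rho>: "0 < \<rho>"
    "\<And>s. \<bar>s - t\<bar> < \<rho> \<Longrightarrow> cmod (g s - g t - complex_of_real (s - t) * v) \<le> (m * cmod v / 4) * \<bar>s - t\<bar>"
    using regular_approx[OF reg, of "m * cmod v / 4"] m t by auto
  define K where "K = g ` ({0..1} \<inter> {s. \<rho> \<le> \<bar>s - t\<bar>})"
  have "compact ({0..1} \<inter> {s. \<rho> \<le> \<bar>s - t\<bar>})"
    by (intro compact_Int_closed compact_Icc closed_Collect_le continuous_intros)
  then have "compact K"
    unfolding K_def by (intro compact_continuous_image continuous_on_subset[OF continuous_g]) auto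
  moreover have "g t \<notin> K"
    unfolding K_def using interior_param_unique[OF _ t(1,2)] \<rho>(1) by force
  ultimately obtain d where d: "0 < d" "\<And>x. x \<in> K \<Longrightarrow> d \<le> dist (g t) x"
    by (meson compact_imp_closed separate_point_closed)
  \<comment> \<open>The cone yields \<open>m * cmod v / 2\<close>, half of which is spent on the
    deviation from the tangent. The other entry covers far parameters, since
    \<open>\<bar>s - t\<bar>\<close> is at most 1.\<close>
  define c where "c = min (m * cmod v / 4) (d / 2)"
  show thesis
  proof (rule that[of c "d / 2"])
    show "0 < c" "0 < d / 2" using m t d by (auto simp: c_def)
  next
    fix z s assume z: "cmod (z - g t) < d / 2"
      and cone: "\<mu> * cmod ((z - g t) / v) \<le> \<bar>Im ((z - g t) / v)\<bar>" and s: "s \<in> {0..1::real}"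
    show "c * \<bar>s - t\<bar> \<le> cmod (z - g s)"
    proof (cases "\<bar>s - t\<bar> < \<rho>")
      case True
      have "m * cmod ((z - g t) / v) \<le> \<bar>Im ((z - g t) / v)\<bar>"
        using cone m by (meson mult_right_mono norm_ge_zero order_trans)
      from dist_real_axis_cone[OF this m(1,2), of "s - t"]
      have "m / 2 * \<bar>s - t\<bar> * cmod v \<le> cmod ((z - g t) / v - of_real (s - t)) * cmod v"
        by (rule mult_right_mono) auto
      also have "\<dots> = cmod (((z - g t) / v - of_real (s - t)) * v)"
        by (simp only: norm_mult)
      also have "cmod (((z - g t) / v - of_real (s - t)) * v) = cmod ((z - g t) - of_real (s - t) * v)"
        using t(3) by (simp add: left_diff_distrib diff_divide_distrib)
      also have "\<dots> \<le> cmod (z - g s) + cmod (g s - g t - complex_of_real (s - t) * v)"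
        by (rule order_trans[OF _ norm_triangle_ineq]) (simp add: algebra_simps)
      finally have "m * cmod v / 4 * \<bar>s - t\<bar> \<le> cmod (z - g s)"
        using \<rho>(2)[OF True] by (simp add: algebra_simps)
      moreover have "c * \<bar>s - t\<bar> \<le> m * cmod v / 4 * \<bar>s - t\<bar>"
        unfolding c_def by (intro mult_right_mono min.cobounded1) auto
      ultimately show ?thesis by linarith
    next
      case False
      with s have "d \<le> dist (g t) (g s)" by (intro d(2)) (auto simp: K_def)
      also have "\<dots> \<le> cmod (z - g t) + cmod (z - g s)"
        by (metis dist_norm dist_triangle2 dist_commute)
      finally have "d / 2 \<le> cmod (z - g s)" using z by simp
      moreover have "c * \<bar>s - t\<bar> \<le> (d / 2) * 1"
        using s t d by (intro mult_mono) (auto simp: c_def)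
      ultimately show ?thesis by simp
    qed
  qed
qed

text \<open>If both points \<open>g t \<plusminus> \<i> \<epsilon> v\<close> were in D, the winding numbers around them would agree, so the
  quotient \<open>q\<close> below would have a continuous logarithm with equal end values. Since \<open>q\<close> meets the
  negative axis only at parameter t, that logarithm is the principal one up to a constant, and
  its imaginary part would have to be both nonnegative and nonpositive at t, where \<open>q = -1\<close>.\<close>
lemma not_both_sides_inside:
  assumes reg: "regular t v" and e: "0 < \<epsilon>"
    and seg: "\<And>y. \<bar>y\<bar> \<le> \<epsilon> \<Longrightarrow> y \<noteq> 0 \<Longrightarrow> g t + \<i> * complex_of_real y * v \<notin> path_image g"
  shows "\<not> (g t + \<i> * complex_of_real \<epsilon> * v \<in> D \<and> g t - \<i> * complex_of_real \<epsilon> * v \<in> D)"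
proof
  note t = regularD[OF reg]
  define p where "p = g t + \<i> * complex_of_real \<epsilon> * v"
  define m where "m = g t - \<i> * complex_of_real \<epsilon> * v"
  assume "g t + \<i> * complex_of_real \<epsilon> * v \<in> D \<and> g t - \<i> * complex_of_real \<epsilon> * v \<in> D"
  then have pm: "p \<in> D" "m \<in> D" by (auto simp: p_def m_def)
  with D_disjoint have pmg: "p \<notin> path_image g" "m \<notin> path_image g" by blast+
  obtain a where a: "path a" "pathfinish a - pathstart a = 2 * of_real pi * \<i> * winding_number g p"
      "\<And>s. s \<in> {0..1} \<Longrightarrow> g s = p + exp (a s)"
    using winding_number_as_continuous_log[OF path_g pmg(1)] by metis
  obtain b where b: "path b" "pathfinish b - pathstart b = 2 * of_real pi * \<i> * winding_number g m"
      "\<And>s. s \<in> {0..1} \<Longrightarrow> g s = m + exp (b s)"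
    using winding_number_as_continuous_log[OF path_g pmg(2)] by metis
  have wn: "winding_number g p = winding_number g m"
    using winding_number_eq[OF path_g loop pm connected_D D_disjoint] .
  define l where "l s = a s - b s" for s
  have l_cont: "continuous_on {0..1} l"
    using a(1) b(1) unfolding l_def path_def by (intro continuous_intros)
  have l01: "l 0 = l 1"
    using a(2) b(2) wn unfolding l_def pathfinish_def pathstart_def by (simp add: algebra_simps)
  define w where "w s = (g s - g t) / v" for s
  define q where "q s = (g s - p) / (g s - m)" for s
  have q_exp: "q s = exp (l s)" if "s \<in> {0..1}" for s
  proof -
    have "g s - p = exp (a s)" "g s - m = exp (b s)"
      using a(3)[OF that] b(3)[OF that] by (metis add_diff_cancel_left')+
    then show ?thesis unfolding q_def l_def exp_diff by simp
  qed
  have q_w: "q s = (w s - \<i> * of_real \<epsilon>) / (w s + \<i> * of_real \<epsilon>)" for s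
  proof -
    have "g s - p = v * (w s - \<i> * of_real \<epsilon>)" "g s - m = v * (w s + \<i> * of_real \<epsilon>)"
      using t(3) unfolding p_def m_def w_def by (auto simp: field_simps)
    then show ?thesis unfolding q_def using t(3) by simp
  qed
  have den: "w s + \<i> * of_real \<epsilon> \<noteq> 0" if "s \<in> {0..1}" for s
    using q_w[of s] q_exp[OF that] by (metis div_by_0 exp_not_eq_zero)
  have Re_q: "Re (q s) = ((Re (w s))\<^sup>2 + (Im (w s))\<^sup>2 - \<epsilon>\<^sup>2) / (cmod (w s + \<i> * of_real \<epsilon>))\<^sup>2"
    and Im_q: "Im (q s) = - 2 * \<epsilon> * Re (w s) / (cmod (w s + \<i> * of_real \<epsilon>))\<^sup>2" for s
    unfolding q_w Re_divide Im_divide cmod_power2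
    by (simp_all add: power2_eq_square algebra_simps diff_divide_distrib add_divide_distrib)
  have q_slit: "q s \<notin> \<real>\<^sub>\<le>\<^sub>0" if s: "s \<in> {0..1}" "s \<noteq> t" for s
  proof
    assume "q s \<in> \<real>\<^sub>\<le>\<^sub>0"
    then have "Im (q s) = 0" "Re (q s) \<le> 0" by (auto simp: complex_nonpos_Reals_iff)
    with den[OF s(1)] e have "Re (w s) = 0" "(Im (w s))\<^sup>2 \<le> \<epsilon>\<^sup>2"
      unfolding Re_q Im_q by (auto simp: divide_le_0_iff)
    then have wi: "\<bar>Im (w s)\<bar> \<le> \<epsilon>" "w s = \<i> * of_real (Im (w s))"
      using e by (auto simp: abs_le_square_iff[symmetric] complex_eq_iff)
    have gs: "g s = g t + w s * v" using t(3) by (simp add: w_def)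
    with wi have "Im (w s) = 0"
      using seg[of "Im (w s)"] in_path_image[OF s(1)] by metis
    with wi(2) gs have "g s = g t" by auto
    then show False using interior_param_unique[OF s(1) t(1,2)] s(2) by simp
  qed
  have w_cont: "continuous_on {0..1} w"
    unfolding w_def using t(3) by (intro continuous_intros continuous_g) auto
  have q_cont: "continuous_on {0..1} q"
    unfolding q_w using den by (intro continuous_intros w_cont) auto
  \<comment> \<open>Its values are periods of \<open>exp\<close>, spaced by multiples of
    \<open>2 * pi\<close>, so it is constant on connected sets of parameters where the principal
    branch is continuous.\<close>
  define k where "k s = l s - Ln (q s)" for s
  have exp_k: "exp (k s) = 1" if "s \<in> {0..1}" for s
    using q_exp[OF that] by (simp add: k_def exp_diff)
  have k_const: "k s = k s'" if "connected S" "S \<subseteq> {0..1} - {t}" "s \<in> S" "s' \<in> S" for S s s'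
  proof -
    have "q s \<notin> \<real>\<^sub>\<le>\<^sub>0" if "s \<in> S" for s using q_slit[of s] \<open>S \<subseteq> _\<close> that by blast
    moreover have "S \<subseteq> {0..1}" using that(2) by blast
    ultimately have "continuous_on S k"
      unfolding k_def
      by (intro continuous_intros continuous_on_subset[OF l_cont] continuous_on_subset[OF q_cont])
    moreover have "k ` S \<subseteq> {z. exp z = 1}" using exp_k that(2) by auto
    ultimately have "k constant_on S"
    proof (intro continuous_discrete_range_constant[OF that(1)])
      fix x assume "x \<in> S"
      show "\<exists>e>0. \<forall>y. y \<in> S \<and> k y \<noteq> k x \<longrightarrow> e \<le> cmod (k y - k x)"
      proof (intro exI[of _ "2 * pi"] conjI allI impI)
        fix y assume y: "y \<in> S \<and> k y \<noteq> k x"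
        have "exp (k y - k x) = 1" using y \<open>x \<in> S\<close> that(2) exp_k by (auto simp: exp_diff subset_iff)
        then obtain n :: int where n: "Re (k y - k x) = 0" "Im (k y - k x) = of_int (2 * n) * pi"
          unfolding exp_eq_1 by auto
        with y have "n \<noteq> 0" by (auto simp: complex_eq_iff)
        then have "1 \<le> \<bar>real_of_int n\<bar>" by linarith
        then have "2 * pi * 1 \<le> 2 * pi * \<bar>real_of_int n\<bar>" by (intro mult_left_mono) auto
        also have "\<dots> = \<bar>Im (k y - k x)\<bar>" using n by (simp add: abs_mult)
        also have "\<dots> \<le> cmod (k y - k x)" by (rule abs_Im_le_cmod)
        finally show "2 * pi \<le> cmod (k y - k x)" by simp
      qed simp
    qed
    then show ?thesis using that by (auto simp: constant_on_def)
  qed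
  \<comment> \<open>The arcs before and after \<open>t\<close> meet at the closing point of the
    loop; equality of the winding numbers makes the two constants agree.\<close>
  have "q 0 = q 1" using q_exp[of 0] q_exp[of 1] l01 by simp
  then have k01: "k 0 = k 1" using l01 by (simp add: k_def)
  have k_eq: "k s = k 0" if "s \<in> {0..1}" "s \<noteq> t" for s
  proof (cases "s < t")
    case True
    then show ?thesis using that t by (intro k_const[of "{0..<t}"]) auto
  next
    case False
    then have "k s = k 1" using that t by (intro k_const[of "{t<..1}"]) auto
    then show ?thesis using k01 by simp
  qed
  have lim_l: "((\<lambda>s. Im (l s - k 0)) \<longlongrightarrow> Im (l t - k 0)) (at t)"
  proof -
    have "isCont l t"
      using l_cont t by (intro continuous_on_interior[of "{0..1}"]) auto
    then show ?thesis by (intro tendsto_intros) (auto simp: isCont_def)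
  qed
  obtain \<rho> where \<rho>: "0 < \<rho>"
    "\<And>s. \<bar>s - t\<bar> < \<rho> \<Longrightarrow> cmod (g s - g t - complex_of_real (s - t) * v) \<le> (cmod v / 2) * \<bar>s - t\<bar>"
    using regular_approx[OF reg, of "cmod v / 2"] t by auto
  have Re_w: "\<bar>Re (w s) - (s - t)\<bar> \<le> \<bar>s - t\<bar> / 2" if "\<bar>s - t\<bar> < \<rho>" for s
  proof -
    have "\<bar>Re (w s - of_real (s - t))\<bar> \<le> cmod (w s - of_real (s - t))" by (rule abs_Re_le_cmod)
    also have "\<dots> = cmod (g s - g t - complex_of_real (s - t) * v) / cmod v"
      using t(3) by (simp add: w_def field_simps flip: norm_divide)
    also have "\<dots> \<le> \<bar>s - t\<bar> / 2"
      using \<rho>(2)[OF that] t(3) by (simp add: field_simps)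
    finally show ?thesis by simp
  qed
  have l_Ln: "l s - k 0 = Ln (q s)" if "s \<in> {0..1}" "s \<noteq> t" for s
    using k_eq[OF that] by (simp add: k_def algebra_simps)
  \<comment> \<open>Off the slit the imaginary part of \<open>Ln\<close> has the sign of that of its
    argument, and by \<open>Im_q\<close> this is opposite to the sign of \<open>Re (w s)\<close>,
    hence of \<open>s - t\<close> near \<open>t\<close>.\<close>
  have Im_sign: "Im (l s - k 0) < 0 \<longleftrightarrow> 0 < Re (w s)" if "s \<in> {0..1}" "s \<noteq> t" for s
  proof -
    have "q s \<noteq> 0" using q_exp that by simp
    then have "Im (Ln (q s)) < 0 \<longleftrightarrow> Im (q s) < 0"
      using Im_Ln_pos_le[of "q s"] q_slit[OF that]  
      by (smt (verit) Im_Ln_eq_pi complex_nonpos_Reals_iff Im_Ln_le_pi mpi_less_Im_Ln)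
    then show ?thesis
      using l_Ln[OF that] den[OF that(1)] e unfolding Im_q
      by (auto simp: zero_less_divide_iff divide_less_0_iff zero_less_mult_iff mult_less_0_iff)
  qed
  have "eventually (\<lambda>s. s \<in> {t<..<min 1 (t + \<rho>)}) (at_right t)"
    using t \<rho>(1) by (intro eventually_at_right_real) auto
  then have "eventually (\<lambda>s. Im (l s - k 0) \<le> 0) (at_right t)"
  proof eventually_elim
    case (elim s)
    then have "0 < Re (w s)" using Re_w[of s] by (auto simp: abs_if split: if_splits)
    then show ?case using Im_sign[of s] elim t by auto
  qed
  moreover have "((\<lambda>s. Im (l s - k 0)) \<longlongrightarrow> Im (l t - k 0)) (at_right t)"
    using lim_l by (rule filterlim_mono) (auto simp: at_le)
  ultimately have "Im (l t - k 0) \<le> 0"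
    by (intro tendsto_upperbound) auto
  have "eventually (\<lambda>s. s \<in> {max 0 (t - \<rho>)<..<t}) (at_left t)"
    using t \<rho>(1) by (intro eventually_at_left_real) auto
  then have "eventually (\<lambda>s. 0 \<le> Im (l s - k 0)) (at_left t)"
  proof eventually_elim
    case (elim s)
    then have "\<not> 0 < Re (w s)" using Re_w[of s] by (auto simp: abs_if split: if_splits)
    then show ?case using Im_sign[of s] elim t by auto
  qed
  moreover have "((\<lambda>s. Im (l s - k 0)) \<longlongrightarrow> Im (l t - k 0)) (at_left t)"
    using lim_l by (rule filterlim_mono) (auto simp: at_le)
  ultimately have "0 \<le> Im (l t - k 0)"
    by (intro tendsto_lowerbound) auto
  with \<open>Im (l t - k 0) \<le> 0\<close> have "Im (l t - k 0) = 0" by simp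
  then have "0 < Re (exp (l t - k 0))" by (simp add: Re_exp)
  moreover have "exp (l t - k 0) = q t"
    using exp_k[of 0] q_exp[of t] t by (simp add: exp_diff)
  moreover have "q t = -1" unfolding q_w using e by (simp add: w_def field_simps)
  ultimately show False by simp
qed

text \<open>Each half cone about the normal is connected and misses the curve, the frontier of
  \<open>D\<close>, so it lies in \<open>D\<close> or is disjoint from it, and
  \<open>not_both_sides_inside\<close> forbids that both lie in \<open>D\<close>. The vector
  \<open>u\<close> is oriented so that \<open>- \<i> * u\<close> points into an outer half cone,
  where the second pole of a dipole will be placed.\<close>

lemma one_side_outside:
  assumes reg: "regular t v" and R: "0 < R"
    and cone: "\<And>z. \<lbrakk>0 < cmod (z - g t); cmod (z - g t) < R;
      1 / 2 * cmod ((z - g t) / v) < \<bar>Im ((z - g t) / v)\<bar>\<rbrakk> \<Longrightarrow> z \<notin> path_image g"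
  obtains u where "u = v \<or> u = - v"
    "\<And>z. \<lbrakk>z \<in> D \<union> path_image g; cmod (z - g t) < R\<rbrakk>
      \<Longrightarrow> - (1 / 2) * cmod ((z - g t) / u) \<le> Im ((z - g t) / u)"
proof -
  note t = regularD[OF reg]
  define C where "C = {w. 1 / 2 * cmod w < Im w} \<inter> ball 0 (R / cmod v)"
  define U where "U u = (\<lambda>w. g t + u * w) ` C" for u
  have U_iff: "z \<in> U u \<longleftrightarrow> cmod (z - g t) < R \<and> 1 / 2 * cmod ((z - g t) / u) < Im ((z - g t) / u)"
    if "u = v \<or> u = - v" for z u
  proof -
    have "u \<noteq> 0" "cmod u = cmod v" using that t by auto
    then have "z \<in> U u \<longleftrightarrow> (z - g t) / u \<in> C"
      unfolding U_def by (auto simp: image_iff intro!: bexI[of _ "(z - g t) / u"])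
    also have "\<dots> \<longleftrightarrow> cmod (z - g t) < R \<and> 1 / 2 * cmod ((z - g t) / u) < Im ((z - g t) / u)"
      using \<open>u \<noteq> 0\<close> \<open>cmod u = _\<close> by (auto simp: C_def norm_divide divide_less_cancel)
    finally show ?thesis .
  qed
  have U_connected: "connected (U u)" for u
    unfolding U_def C_def
    by (intro connected_continuous_image convex_connected convex_Int convex_upper_cone convex_ball
        continuous_intros) auto
  have U_disj: "U u \<inter> path_image g = {}" if u: "u = v \<or> u = - v" for u
  proof -
    have "z \<notin> path_image g" if z: "z \<in> U u" for z
    proof (rule cone)
      have *: "cmod (z - g t) < R" "1 / 2 * cmod ((z - g t) / u) < Im ((z - g t) / u)"
        using z U_iff[OF u] by auto
      then show "cmod (z - g t) < R" by simp
      show "0 < cmod (z - g t)" using * by auto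
      show "1 / 2 * cmod ((z - g t) / v) < \<bar>Im ((z - g t) / v)\<bar>"
        using * u by auto
    qed
    then show ?thesis by auto
  qed
  have U_D: "U u \<subseteq> D" if "u = v \<or> u = - v" "U u \<inter> D \<noteq> {}" for u
  proof (rule ccontr)
    assume "\<not> U u \<subseteq> D"
    then have "U u \<inter> frontier D \<noteq> {}"
      using connected_Int_frontier[OF U_connected[of u] that(2)] by auto
    then show False
      using Jordan_inside_outside[OF simple loop] U_disj[OF that(1)] by auto
  qed
  have "\<not> (U v \<subseteq> D \<and> U (- v) \<subseteq> D)"
  proof
    assume *: "U v \<subseteq> D \<and> U (- v) \<subseteq> D"
    define \<epsilon> where "\<epsilon> = R / (2 * cmod v)"
    have e: "0 < \<epsilon>" using R t by (simp add: \<epsilon>_def)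
    have "\<not> (g t + \<i> * complex_of_real \<epsilon> * v \<in> D \<and> g t - \<i> * complex_of_real \<epsilon> * v \<in> D)"
    proof (rule not_both_sides_inside[OF reg e])
      fix y :: real assume y: "\<bar>y\<bar> \<le> \<epsilon>" "y \<noteq> 0"
      have "\<bar>y\<bar> * cmod v \<le> \<epsilon> * cmod v" using y by (intro mult_right_mono) auto
      also have "\<dots> < R" using R t by (simp add: \<epsilon>_def field_simps)
      finally have "\<bar>y\<bar> * cmod v < R" .
      then show "g t + \<i> * complex_of_real y * v \<notin> path_image g"
        using y t by (intro cone) (auto simp: norm_mult norm_divide)
    qed
    moreover have "g t + \<i> * complex_of_real \<epsilon> * v \<in> U v" "g t - \<i> * complex_of_real \<epsilon> * v \<in> U (- v)"
      using e t R by (subst U_iff; auto simp: norm_mult norm_divide \<epsilon>_def field_simps)+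
    ultimately show False using * by auto
  qed
  then obtain u where u: "u = v \<or> u = - v" "U (- u) \<inter> D = {}"
    using U_D by (metis minus_minus)
  show thesis
  proof (rule that[OF u(1)])
    fix z assume "z \<in> D \<union> path_image g" "cmod (z - g t) < R"
    moreover have "- u = v \<or> - u = - v" using u by auto
    ultimately have "\<not> 1 / 2 * cmod ((z - g t) / (- u)) < Im ((z - g t) / (- u))"
      using u(2) U_disj[of "- u"] U_iff[of "- u" z] by auto
    then show "- (1 / 2) * cmod ((z - g t) / u) \<le> Im ((z - g t) / u)" by simp
  qed
qed

end

section \<open>Dipole kernels and lattice sums\<close>

text \<open>This is \<open>\<i> / (w + \<i>) - \<i> / w\<close>: unlike a single pole it decays quadratically, which makes sums over a
  partition converge, and the pole at 0 does not contribute to the real part on the real axis.\<close>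
definition kern :: "complex \<Rightarrow> complex" where "kern w = 1 / (w * (w + \<i>))"

section \<open>Estimates for a single dipole\<close>

lemma Re_kern_of_real: "x \<noteq> 0 \<Longrightarrow> Re (kern (complex_of_real x)) = 1 / (1 + x\<^sup>2)"
proof -
  assume x: "x \<noteq> 0"
  have "Re (kern (complex_of_real x)) = (x * x) / ((x * x) * (1 + x\<^sup>2))"
    by (simp add: kern_def Re_divide power2_eq_square algebra_simps)
  with x show ?thesis by simp
qed

text \<open>Outside the cone around the negative imaginary axis the squared modulus of
  \<open>w + \<i>\<close> is at least \<open>(cmod w)\<^sup>2 + 1 - cmod w\<close>, a quadratic
  without real zeros. Linear growth of the lower bound preserves the quadratic decay of
  \<open>kern\<close>.\<close>

lemma norm_add_ii_ge_cone:
  assumes "- (1 / 2) * cmod w \<le> Im w"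
  shows "(1 + cmod w) / 3 \<le> cmod (w + \<i>)"
proof (rule power2_le_imp_le)
  have "(cmod (w + \<i>))\<^sup>2 = (cmod w)\<^sup>2 + 1 + 2 * Im w"
    unfolding cmod_power2 by (simp add: power2_eq_square algebra_simps)
  moreover have "((1 + cmod w) / 3)\<^sup>2 \<le> (cmod w)\<^sup>2 + 1 - cmod w"
  proof -
    \<comment> \<open>Nine times the difference of the two sides is
      \<open>8 * x\<^sup>2 - 11 * x + 8\<close> at \<open>x = cmod w\<close>, whose vertex is at
      11/16.\<close>
    have "0 \<le> 8 * (cmod w - 11 / 16)\<^sup>2" by simp
    then show ?thesis by (simp add: power2_eq_square field_simps)
  qed
  ultimately show "((1 + cmod w) / 3)\<^sup>2 \<le> (cmod (w + \<i>))\<^sup>2" using assms by simp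
qed simp

text \<open>Replaces the cone condition at points too far away for the tangent to tell the sides
  apart: \<open>cmod w - 1\<close> reaches \<open>(1 + cmod w) / 3\<close> exactly at modulus
  2.\<close>

lemma norm_add_ii_ge_far:
  assumes "2 \<le> cmod w"
  shows "(1 + cmod w) / 3 \<le> cmod (w + \<i>)"
proof -
  have "cmod w \<le> cmod (w + \<i>) + cmod \<i>"
    by (metis add_diff_cancel_right' norm_triangle_ineq4)
  with assms show ?thesis by simp
qed

text \<open>Here \<open>x\<close> stands for a parameter distance in units of the mesh. The factor
  \<open>1 / x\<close> reflects the pole on the curve and \<open>1 / (1 + x)\<close> the one just
  off it; together they are summable over the mesh.\<close>

lemma norm_kern_le:
  assumes "(1 + cmod w) / 3 \<le> cmod (w + \<i>)" "c * x \<le> cmod w" "0 < x" "0 < c" "c \<le> 1"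
  shows "cmod (kern w) \<le> 3 / c\<^sup>2 * (1 / (x * (1 + x)))"
proof -
  have "c * (1 + x) \<le> 1 + c * x" using assms by (simp add: algebra_simps)
  also have "\<dots> \<le> 1 + cmod w" using assms by simp
  finally have *: "c * (1 + x) \<le> 3 * cmod (w + \<i>)" using assms(1) by simp
  have "(c * x) * (c * (1 + x)) \<le> cmod w * (3 * cmod (w + \<i>))"
    by (rule mult_mono) (use assms * in auto)
  then have "1 / (cmod w * (3 * cmod (w + \<i>))) \<le> 1 / ((c * x) * (c * (1 + x)))"
  proof -
    have "0 < c * x" "0 < c * (1 + x)" using assms by simp_all
    then have "0 < cmod w" "0 < cmod (w + \<i>)" using assms(2) * by linarith+
    with \<open>(c * x) * _ \<le> _\<close> show ?thesis
      using assms by (intro divide_left_mono mult_pos_pos) auto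
  qed
  then have "3 * (1 / (cmod w * (3 * cmod (w + \<i>)))) \<le> 3 * (1 / ((c * x) * (c * (1 + x))))"
    by (rule mult_left_mono) simp
  then show ?thesis
    by (simp add: kern_def norm_divide norm_mult power2_eq_square mult.assoc mult.left_commute)
qed

text \<open>Straightening the curve moves the argument by a relative error \<open>e\<close>. In the
  split difference the factor \<open>\<bar>x\<bar>\<close> of that error cancels one of the three
  factors of each denominator, so the weight of \<open>norm_kern_le\<close> comes back with
  \<open>e\<close> in front. The constant is 9 + 3, merged by \<open>c \<le> 1\<close>.\<close>

lemma norm_kern_diff_le:
  fixes x :: real
  assumes w: "(1 + cmod w) / 3 \<le> cmod (w + \<i>)" and near: "cmod (w - of_real x) \<le> e * \<bar>x\<bar>"
    and c: "c * \<bar>x\<bar> \<le> cmod w" "0 < c" "c \<le> 1" and x: "x \<noteq> 0"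
  shows "cmod (kern w - kern (of_real x)) \<le> 12 * e / c\<^sup>2 * (1 / (\<bar>x\<bar> * (1 + \<bar>x\<bar>)))"
proof -
  have e: "0 \<le> e" using near x by (metis abs_le_zero_iff mult_less_0_iff norm_ge_zero not_le order_trans abs_ge_zero less_le)
  have x3: "(1 + \<bar>x\<bar>) / 3 \<le> cmod (of_real x + \<i>)"
    using norm_add_ii_ge_cone[of "of_real x"] by simp
  have pos: "0 < c * \<bar>x\<bar>" using c x by simp
  then have "w \<noteq> 0" using c by auto
  have "w + \<i> \<noteq> 0" using w by (smt (verit) norm_eq_zero norm_ge_zero divide_pos_pos)
  have "complex_of_real x + \<i> \<noteq> 0" by (simp add: complex_eq_iff)
  have "kern w - kern (of_real x) =
      (of_real x - w) / (w * (w + \<i>) * (of_real x + \<i>)) + (of_real x - w) / (w * of_real x * (of_real x + \<i>))"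
    unfolding kern_def using \<open>w \<noteq> 0\<close> \<open>w + \<i> \<noteq> 0\<close> \<open>complex_of_real x + \<i> \<noteq> 0\<close> x
    by (simp add: divide_simps) (simp add: algebra_simps)
  then have "cmod (kern w - kern (of_real x)) \<le> cmod (of_real x - w) / (cmod w * cmod (w + \<i>) * cmod (of_real x + \<i>))
      + cmod (of_real x - w) / (cmod w * \<bar>x\<bar> * cmod (of_real x + \<i>))"
    by (metis norm_triangle_ineq norm_divide norm_mult norm_of_real)
  also have "\<dots> \<le> (e * \<bar>x\<bar>) / ((c * \<bar>x\<bar>) * ((c * \<bar>x\<bar>) / 3) * ((1 + \<bar>x\<bar>) / 3))
      + (e * \<bar>x\<bar>) / ((c * \<bar>x\<bar>) * \<bar>x\<bar> * ((1 + \<bar>x\<bar>) / 3))"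
    using near w c x3 pos e x
    by (intro add_mono frac_le mult_mono mult_nonneg_nonneg mult_pos_pos)
       (auto simp: norm_minus_commute)
  also have "\<dots> = (9 * e / c\<^sup>2 + 3 * e / c) * (1 / (\<bar>x\<bar> * (1 + \<bar>x\<bar>)))"
    using c x by (simp add: power2_eq_square divide_simps)
  also have "\<dots> \<le> (12 * e / c\<^sup>2) * (1 / (\<bar>x\<bar> * (1 + \<bar>x\<bar>)))"
  proof (rule mult_right_mono)
    have "3 * e * c \<le> 3 * e * 1" using c e by (intro mult_left_mono) auto
    then show "9 * e / c\<^sup>2 + 3 * e / c \<le> 12 * e / c\<^sup>2"
      using c by (simp add: power2_eq_square divide_simps)
  qed simp
  finally show ?thesis .
qed

section \<open>Sums over the cells of a partition\<close>

lemma sum_inverse_square_le: "(\<Sum>i<n. 1 / (1 + real i)\<^sup>2) \<le> 2"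
proof -
  \<comment> \<open>The subtracted \<open>1 / (1 + real n)\<close> lets the induction close by
    telescoping.\<close>
  have "(\<Sum>i<Suc n. 1 / (1 + real i)\<^sup>2) \<le> 2 - 1 / (1 + real n)" for n
  proof (induction n)
    case (Suc n)
    have "1 / (2 + real n)\<^sup>2 \<le> 1 / (1 + real n) - 1 / (2 + real n)"
    proof -
      have "1 / (2 + real n)\<^sup>2 \<le> 1 / ((1 + real n) * (2 + real n))"
        by (intro divide_left_mono mult_pos_pos zero_less_power) (auto simp: power2_eq_square algebra_simps)
      also have "\<dots> = 1 / (1 + real n) - 1 / (2 + real n)"
        by (simp add: divide_simps)
      finally show ?thesis .
    qed
    with Suc show ?case by (simp add: algebra_simps)
  qed simp
  from this[of n] show ?thesis by (smt (verit) sum.lessThan_Suc zero_le_divide_1_iff zero_le_power2 of_nat_0_le_iff)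
qed

lemma sum_inverse_square_dist_le:
  assumes "finite I"
  shows "(\<Sum>j\<in>I. 1 / (1 + \<bar>real j - real k\<bar>)\<^sup>2) \<le> 4"
proof -
  have "(\<Sum>j\<in>I. 1 / (1 + \<bar>real j - real k\<bar>)\<^sup>2) =
      (\<Sum>j\<in>I \<inter> {..k}. 1 / (1 + \<bar>real j - real k\<bar>)\<^sup>2) + (\<Sum>j\<in>I \<inter> {k<..}. 1 / (1 + \<bar>real j - real k\<bar>)\<^sup>2)"
    using assms by (subst sum.union_disjoint[symmetric]) (auto intro!: sum.cong)
  also have "(\<Sum>j\<in>I \<inter> {..k}. 1 / (1 + \<bar>real j - real k\<bar>)\<^sup>2) = (\<Sum>i\<in>(\<lambda>j. k - j) ` (I \<inter> {..k}). 1 / (1 + real i)\<^sup>2)"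
    by (subst sum.reindex) (auto simp: inj_on_def of_nat_diff intro!: sum.cong)
  also have "\<dots> \<le> (\<Sum>i<Suc k. 1 / (1 + real i)\<^sup>2)"
    using assms by (intro sum_mono2) auto
  also have "\<dots> \<le> 2" by (rule sum_inverse_square_le)
  also have "(\<Sum>j\<in>I \<inter> {k<..}. 1 / (1 + \<bar>real j - real k\<bar>)\<^sup>2) = (\<Sum>i\<in>(\<lambda>j. j - k) ` (I \<inter> {k<..}). 1 / (1 + real i)\<^sup>2)"
    by (subst sum.reindex) (auto simp: inj_on_def of_nat_diff intro!: sum.cong)
  also have "\<dots> \<le> (\<Sum>i<Suc (Max (insert 0 I)). 1 / (1 + real i)\<^sup>2)"
    using assms by (intro sum_mono2) (auto simp: less_Suc_eq_le intro!: order_trans[OF diff_le_self Max_ge])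
  also have "\<dots> \<le> 2" by (rule sum_inverse_square_le)
  finally show ?thesis by simp
qed

text \<open>The forcing \<open>p ^ n\<close> decays more slowly than the contraction
  \<open>\<theta>\<close> and so dictates the rate. The second entry of the maximum \<open>A\<close>
  closes the induction through \<open>\<theta> * A + 1 \<le> A * p\<close>.\<close>

lemma geometric_decay:
  fixes a :: "nat \<Rightarrow> real"
  assumes step: "\<And>n. n0 \<le> n \<Longrightarrow> a (Suc n) \<le> \<theta> * a n + p ^ n" and a: "\<And>n. 0 \<le> a n"
    and \<theta>: "0 \<le> \<theta>" "\<theta> < p"
  obtains A where "0 \<le> A" "\<And>n. n0 \<le> n \<Longrightarrow> a n \<le> A * p ^ n"
proof -
  have p: "0 < p" using \<theta> by simp
  define A where "A = max (a n0 / p ^ n0) (1 / (p - \<theta>))"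
  have A1: "1 \<le> A * (p - \<theta>)"
  proof -
    have "1 / (p - \<theta>) * (p - \<theta>) \<le> A * (p - \<theta>)" using \<theta> by (intro mult_right_mono) (auto simp: A_def)
    then show ?thesis using \<theta> by simp
  qed
  have "a n \<le> A * p ^ n" if "n0 \<le> n" for n
    using that
  proof (induction n rule: dec_induct)
    case base
    have "a n0 / p ^ n0 * p ^ n0 \<le> A * p ^ n0" using p by (intro mult_right_mono) (auto simp: A_def)
    then show ?case using p by simp
  next
    case (step n)
    have "a (Suc n) \<le> \<theta> * a n + p ^ n" by (rule assms(1)) (use step in simp)
    also have "\<dots> \<le> \<theta> * (A * p ^ n) + p ^ n" using step \<theta> by (intro add_mono mult_left_mono) auto
    also have "\<dots> = (\<theta> * A + 1) * p ^ n" by (simp add: algebra_simps)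
    also have "\<dots> \<le> (A * p) * p ^ n" using A1 p by (intro mult_right_mono) (auto simp: algebra_simps)
    finally show ?case by (simp add: mult.assoc)
  qed
  moreover have "0 \<le> A" using \<theta> by (auto simp: A_def intro: max.coboundedI2)
  ultimately show thesis by (rule that[rotated])
qed

text \<open>\<open>x j\<close> will be the distance from a parameter to the sample in cell
  \<open>j\<close>, in units of the cell length, and \<open>k\<close> the cell of that parameter.
  Points of two cells may be closer than the indices say by one cell, hence the \<open>- 1\<close>.
  In neighbouring cells this bound is void, and only the excised intervals, through
  \<open>\<kappa>\<close>, keep \<open>x j\<close> positive.\<close>

locale spaced_offsets =
  fixes I :: "nat set" and k :: nat and x :: "nat \<Rightarrow> real" and \<kappa> :: real
  assumes finite_I: "finite I" and kappa: "0 < \<kappa>" "\<kappa> \<le> 1"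
    and x_ge: "\<And>j. j \<in> I \<Longrightarrow> \<bar>real j - real k\<bar> - 1 \<le> x j" "\<And>j. j \<in> I \<Longrightarrow> \<kappa> \<le> x j"
begin

lemma offset_cases:
  obtains "\<bar>real j - real k\<bar> \<le> 1" | "2 \<le> \<bar>real j - real k\<bar>"
proof -
  define d where "d = \<bar>int j - int k\<bar>"
  have "\<bar>real j - real k\<bar> = real_of_int d" by (simp add: d_def)
  moreover have "d \<le> 1 \<or> 2 \<le> d" by linarith
  ultimately have "\<bar>real j - real k\<bar> \<le> 1 \<or> 2 \<le> \<bar>real j - real k\<bar>" by auto
  then show thesis using that by blast
qed

lemma sum_weight_le: "(\<Sum>j\<in>I. 1 / (x j * (1 + x j))) \<le> 18 / \<kappa>"
proof -
  have "1 / (x j * (1 + x j)) \<le> 9 / 2 / \<kappa> * (1 / (1 + \<bar>real j - real k\<bar>)\<^sup>2)" if j: "j \<in> I" for j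
  proof -
    define m where "m = \<bar>real j - real k\<bar>"
    have m0: "0 \<le> m" by (simp add: m_def)
    have xj: "\<kappa> \<le> x j" "m - 1 \<le> x j" using x_ge j by (auto simp: m_def)
    show ?thesis
    proof (cases rule: offset_cases[of j])
      case 1
      then have "m \<le> 1" by (simp add: m_def)
      have "\<kappa> * 1 \<le> x j * (1 + x j)" using xj kappa by (intro mult_mono) auto
      then have "1 / (x j * (1 + x j)) \<le> 1 / \<kappa>"
        using kappa by (intro divide_left_mono) auto
      also have "\<dots> = 4 / \<kappa> * (1 / 2\<^sup>2)" by simp
      also have "\<dots> \<le> 9 / 2 / \<kappa> * (1 / (1 + m)\<^sup>2)"
        using kappa m0 \<open>m \<le> 1\<close> by (intro mult_mono divide_left_mono divide_right_mono power_mono) auto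
      finally show ?thesis by (simp add: m_def)
    next
      case 2
      then have m2: "2 \<le> m" by (simp add: m_def)
      have "(m - 1) * m \<le> x j * (1 + x j)" using xj m2 kappa by (intro mult_mono) auto
      moreover have "0 < (m - 1) * m" using m2 by simp
      ultimately have "1 / (x j * (1 + x j)) \<le> 1 / ((m - 1) * m)"
        by (intro divide_left_mono) auto
      also have "\<dots> \<le> 9 / 2 * (1 / (1 + m)\<^sup>2)"
      proof -
        \<comment> \<open>The product equals \<open>9 * ((m - 1) * m) - 2 * (1 + m)\<^sup>2\<close>.
          It vanishes at the smallest \<open>m\<close> of this case, which fixes the constant
          9/2.\<close>
        have "0 \<le> (7 * m + 1) * (m - 2)" using m2 by (intro mult_nonneg_nonneg) auto
        then have "2 * (1 + m)\<^sup>2 \<le> 9 * ((m - 1) * m)" by (simp add: power2_eq_square algebra_simps)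
        then show ?thesis using \<open>0 < (m - 1) * m\<close> m2
          by (simp add: divide_simps)
      qed
      also have "\<dots> \<le> 9 / 2 / \<kappa> * (1 / (1 + m)\<^sup>2)"
        using kappa by (intro mult_right_mono) (auto simp: field_simps)
      finally show ?thesis by (simp add: m_def)
    qed
  qed
  then have "(\<Sum>j\<in>I. 1 / (x j * (1 + x j))) \<le> (\<Sum>j\<in>I. 9 / 2 / \<kappa> * (1 / (1 + \<bar>real j - real k\<bar>)\<^sup>2))"
    by (rule sum_mono)
  also have "\<dots> = 9 / 2 / \<kappa> * (\<Sum>j\<in>I. 1 / (1 + \<bar>real j - real k\<bar>)\<^sup>2)"
    by (simp add: sum_distrib_left)
  also have "\<dots> \<le> 9 / 2 / \<kappa> * 4"
    using kappa by (intro mult_left_mono sum_inverse_square_dist_le finite_I) auto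
  finally show ?thesis by simp
qed

text \<open>The Poisson kernel is bounded at 0, so in contrast to \<open>sum_weight_le\<close> no
  \<open>\<kappa>\<close> enters. The absolute constant 20 becomes the normalisation of the
  correction.\<close>

lemma sum_poisson_le: "(\<Sum>j\<in>I. 1 / (1 + (x j)\<^sup>2)) \<le> 20"
proof -
  have "1 / (1 + (x j)\<^sup>2) \<le> 5 * (1 / (1 + \<bar>real j - real k\<bar>)\<^sup>2)" if j: "j \<in> I" for j
  proof -
    define m where "m = \<bar>real j - real k\<bar>"
    have m0: "0 \<le> m" by (simp add: m_def)
    have xj: "\<kappa> \<le> x j" "m - 1 \<le> x j" using x_ge j by (auto simp: m_def)
    have "(1 + m)\<^sup>2 \<le> 5 * (1 + (x j)\<^sup>2)"
    proof (cases rule: offset_cases[of j])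
      case 1
      then have "(1 + m)\<^sup>2 \<le> 2\<^sup>2" using m0 by (intro power_mono) (auto simp: m_def)
      then have "(1 + m)\<^sup>2 \<le> 5 * 1" by simp
      also have "5 * 1 \<le> 5 * (1 + (x j)\<^sup>2)" by (intro mult_left_mono) auto
      finally show ?thesis .
    next
      case 2
      then have "(m - 1)\<^sup>2 \<le> (x j)\<^sup>2" using xj by (intro power_mono) (auto simp: m_def)
      \<comment> \<open>This square is
        \<open>5 * (1 + (m - 1)\<^sup>2) - (1 + m)\<^sup>2\<close>.\<close>
      moreover have "0 \<le> (2 * m - 3)\<^sup>2" by simp
      ultimately show ?thesis by (simp add: power2_eq_square algebra_simps)
    qed
    moreover have "0 < 1 + (x j)\<^sup>2" by (smt (verit) zero_le_power2)
    ultimately show ?thesis using m0 by (simp add: m_def[symmetric] divide_simps)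
  qed
  then have "(\<Sum>j\<in>I. 1 / (1 + (x j)\<^sup>2)) \<le> (\<Sum>j\<in>I. 5 * (1 / (1 + \<bar>real j - real k\<bar>)\<^sup>2))"
    by (rule sum_mono)
  also have "\<dots> = 5 * (\<Sum>j\<in>I. 1 / (1 + \<bar>real j - real k\<bar>)\<^sup>2)"
    by (simp add: sum_distrib_left)
  finally show ?thesis using sum_inverse_square_dist_le[OF finite_I, of k] by simp
qed

text \<open>The growing part \<open>x j / N\<close> costs the logarithmically divergent \<open>1 / N * (\<Sum>j\<in>I. 1 / (1 + x j))\<close>,
  which is tamed by \<open>2 / (1 + x) \<le> a + 1 / (a * (1 + x)\<^sup>2)\<close> with \<open>a = 1 / sqrt N\<close>.\<close>
lemma sum_modulus_le:
  assumes N: "card I \<le> N" "0 < N" and "0 \<le> \<delta>" "0 \<le> C"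
  shows "(\<Sum>j\<in>I. (\<delta> + C * (x j / N)) * (1 / (x j * (1 + x j)))) \<le> 18 / \<kappa> * \<delta> + C * (1 + 18 / \<kappa>) / sqrt N"
proof -
  define r where "r = 1 / sqrt N"
  have r: "0 < r" "r * r = 1 / N" using N by (auto simp: r_def)
  have "(\<delta> + C * (x j / N)) * (1 / (x j * (1 + x j)))
      \<le> (\<delta> + C * r) * (1 / (x j * (1 + x j))) + C * r / N" if j: "j \<in> I" for j
  proof -
    have xj: "0 < x j" using x_ge(2)[OF j] kappa by simp
    define y where "y = 1 / (1 + x j)"
    have y: "0 < y" "y \<le> 1" using xj by (auto simp: y_def)
    have "0 \<le> (r - y)\<^sup>2" by simp
    then have "2 * (r * y) \<le> r * r + y * y" by (simp add: power2_eq_square algebra_simps)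
    then have "r * y \<le> r * r + y * y" using r y mult_pos_pos[OF r(1) y(1)] by linarith
    also have "y * y \<le> 1 / (x j * (1 + x j))"
      using xj by (simp add: y_def divide_simps)
    finally have "(C * r) * (r * y) \<le> (C * r) * (r * r + 1 / (x j * (1 + x j)))"
      using assms r by (intro mult_left_mono) auto
    moreover have "C * (x j / N) * (1 / (x j * (1 + x j))) = (C * r) * (r * y)"
    proof -
      have "C * (x j / N) * (1 / (x j * (1 + x j))) = C * (1 / N) * y"
        using xj by (simp add: y_def divide_simps)
      then show ?thesis by (simp add: mult.assoc flip: r(2))
    qed
    moreover have "C * r / N = (C * r) * (r * r)" by (simp add: r(2))
    ultimately show ?thesis by (simp only: distrib_right distrib_left)
  qed
  then have "(\<Sum>j\<in>I. (\<delta> + C * (x j / N)) * (1 / (x j * (1 + x j))))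
      \<le> (\<Sum>j\<in>I. (\<delta> + C * r) * (1 / (x j * (1 + x j))) + C * r / N)"
    by (rule sum_mono)
  also have "\<dots> = (\<delta> + C * r) * (\<Sum>j\<in>I. 1 / (x j * (1 + x j))) + real (card I) * (C * r / N)"
    by (simp add: sum.distrib sum_distrib_left)
  also have "\<dots> \<le> (\<delta> + C * r) * (18 / \<kappa>) + real N * (C * r / N)"
    using assms r by (intro add_mono mult_left_mono mult_right_mono sum_weight_le) auto
  also have "\<dots> = 18 / \<kappa> * \<delta> + C * (1 + 18 / \<kappa>) * r"
    using N by (simp add: algebra_simps add_divide_distrib)
  finally show ?thesis by (simp add: r_def)
qed

end

section \<open>Egorov and Lusin\<close>

text \<open>Egorov's argument with sets in place of functions: \<open>A q m\<close> collects the
  points where precision \<open>q\<close> is reached with threshold \<open>m\<close>. Finite measure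
  of \<open>T\<close> gives continuity from above, so a threshold can be picked for each
  \<open>q\<close> at the cost \<open>e * (1 / 2) ^ Suc q\<close>. This form serves convergence of
  functions as well as difference quotients.\<close>

lemma egorov_sets:
  fixes A :: "nat \<Rightarrow> nat \<Rightarrow> real set"
  assumes T: "T \<in> lmeasurable" and A: "\<And>q m. A q m \<in> sets lebesgue"
    and mono: "\<And>q m n. m \<le> n \<Longrightarrow> A q m \<subseteq> A q n" and cover: "\<And>q. T \<subseteq> (\<Union>m. A q m)" and e: "0 < e"
  obtains G where "G \<in> sets lebesgue" "G \<subseteq> T" "measure lebesgue (T - G) \<le> e"
    "\<And>q. \<exists>m. G \<subseteq> A q m"
proof -
  have Ts[measurable]: "T \<in> sets lebesgue" using T by auto
  have "\<exists>m. measure lebesgue (T - A q m) \<le> e * (1 / 2) ^ Suc q" for q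
  proof -
    have "(\<lambda>m. measure lebesgue (T - A q m)) \<longlonglongrightarrow> measure lebesgue (\<Inter>m. T - A q m)"
    proof (rule Lim_measure_decseq)
      show "range (\<lambda>m. T - A q m) \<subseteq> sets lebesgue" using A Ts by auto
      show "decseq (\<lambda>m. T - A q m)" using mono by (auto simp: decseq_def)
      have "T - A q m \<in> lmeasurable" for m
        by (rule fmeasurable_Diff[OF T A])
      then show "emeasure lebesgue (T - A q m) \<noteq> \<infinity>" for m
        using fmeasurableD2 by (metis infinity_ennreal_def)
    qed
    moreover have "(\<Inter>m. T - A q m) = {}" using cover[of q] by auto
    ultimately have "(\<lambda>m. measure lebesgue (T - A q m)) \<longlonglongrightarrow> 0" by (simp only: measure_empty)
    moreover have "0 < e * (1 / 2) ^ Suc q" using e by simp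
    ultimately have "eventually (\<lambda>m. measure lebesgue (T - A q m) < e * (1 / 2) ^ Suc q) sequentially"
      by (rule order_tendstoD)
    then show ?thesis by (auto simp: eventually_sequentially intro: less_imp_le)
  qed
  then obtain m where m: "\<And>q. measure lebesgue (T - A q (m q)) \<le> e * (1 / 2) ^ Suc q" by metis
  define G where "G = T \<inter> (\<Inter>q. A q (m q))"
  have G: "G \<in> sets lebesgue"
    unfolding G_def using A by (intro sets.Int[OF Ts] sets.countable_INT) auto
  have sums: "(\<lambda>q. e * (1 / 2) ^ Suc q) sums e"
    using sums_mult[OF power_half_series, of e] by simp
  have "measure lebesgue (T - G) \<le> e"
  proof -
    have eq: "T - G = (\<Union>q. T - A q (m q))" by (auto simp: G_def)
    have meas: "T - A q (m q) \<in> lmeasurable" for q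
      by (rule fmeasurable_Diff[OF T A])
    have "measure lebesgue (\<Union>q. T - A q (m q)) \<le> e"
    proof (rule measure_countable_Union_le)
      fix q
      show "T - A q (m q) \<in> lmeasurable" by (rule meas)
      have "measure lebesgue (\<Union>k\<le>q. T - A k (m k)) \<le> (\<Sum>k\<le>q. measure lebesgue (T - A k (m k)))"
        using meas by (intro measure_UNION_le) auto
      also have "\<dots> \<le> (\<Sum>k\<le>q. e * (1 / 2) ^ Suc k)" by (intro sum_mono m)
      also have "\<dots> \<le> (\<Sum>k. e * (1 / 2) ^ Suc k)"
        using sums e by (intro sum_le_suminf) (auto simp: sums_iff)
      finally show "measure lebesgue (\<Union>k\<le>q. T - A k (m k)) \<le> e" using sums by (simp add: sums_iff)
    qed
    then show ?thesis by (simp add: eq)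
  qed
  moreover have "\<exists>m. G \<subseteq> A q m" for q by (auto simp: G_def)
  ultimately show thesis using that G by (auto simp: G_def)
qed

text \<open>Continuous functions converge to \<open>\<psi>\<close> off a negligible set, uniformly
  on a large set by \<open>egorov_sets\<close>, and each is uniformly continuous on the compact
  interval. Uniform continuity is the form wanted later, since it both bounds \<open>\<psi>\<close>
  on \<open>G\<close> and yields a modulus.\<close>

lemma lusin_uniformly_continuous:
  fixes \<psi> :: "real \<Rightarrow> complex"
  assumes meas: "\<psi> \<in> borel_measurable (lebesgue_on {0..1})" and T: "T \<in> lmeasurable" "T \<subseteq> {0..1}" and e: "0 < e"
  obtains G where "G \<in> sets lebesgue" "G \<subseteq> T" "measure lebesgue (T - G) \<le> e"
    "uniformly_continuous_on G \<psi>"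
proof -
  have "\<psi> measurable_on {0..1}" using meas by (simp add: measurable_on_iff_borel_measurable)
  then obtain N F where N: "negligible N" and F: "\<And>n. continuous_on UNIV (F n)"
    and lim: "\<And>x. x \<notin> N \<Longrightarrow> (\<lambda>n. F n x) \<longlonglongrightarrow> (if x \<in> {0..1} then \<psi> x else 0)"
    unfolding measurable_on_def by metis
  define T' where "T' = T - N"
  have T': "T' \<in> lmeasurable" unfolding T'_def
    using N by (intro fmeasurable_Diff T(1)) (auto simp: negligible_iff_null_sets)
  \<comment> \<open>The Cauchy condition, unlike closeness to \<open>\<psi>\<close>, cuts out closed
    sets, which makes measurability immediate.\<close>
  define A where "A q m = T' \<inter> {t. \<forall>n\<ge>m. \<forall>k\<ge>m. cmod (F n t - F k t) \<le> 1 / Suc q}" for q m :: nat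
  have closed: "closed {t. \<forall>n\<ge>m. \<forall>k\<ge>m. cmod (F n t - F k t) \<le> 1 / Suc q}" for m q :: nat
  proof -
    have "{t. \<forall>n\<ge>m. \<forall>k\<ge>m. cmod (F n t - F k t) \<le> 1 / Suc q} =
        (\<Inter>n\<in>{m..}. \<Inter>k\<in>{m..}. {t. cmod (F n t - F k t) \<le> 1 / Suc q})" by auto
    moreover have "closed {t. cmod (F n t - F k t) \<le> 1 / Suc q}" for n k
      by (intro closed_Collect_le continuous_intros F)
    ultimately show ?thesis by (simp add: closed_INT)
  qed
  obtain G where G: "G \<in> sets lebesgue" "G \<subseteq> T'" "measure lebesgue (T' - G) \<le> e" "\<And>q. \<exists>m. G \<subseteq> A q m"
  proof (rule egorov_sets[of T' A e])
    show "A q m \<in> sets lebesgue" for q m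
      unfolding A_def
    proof (rule sets.Int)
      show "T' \<in> sets lebesgue" using T' by auto
      show "{t. \<forall>n\<ge>m. \<forall>k\<ge>m. cmod (F n t - F k t) \<le> 1 / Suc q} \<in> sets lebesgue"
        by (rule sets_completionI_sets) (simp only: sets_lborel borel_closed[OF closed])
    qed
    show "A q m \<subseteq> A q n" if "m \<le> n" for q m n using that by (auto simp: A_def)
    show "T' \<subseteq> (\<Union>m. A q m)" for q
    proof
      fix t assume t: "t \<in> T'"
      then have "Cauchy (\<lambda>n. F n t)" using lim[of t] by (intro LIMSEQ_imp_Cauchy) (auto simp: T'_def)
      then obtain M where "\<And>n k. n \<ge> M \<Longrightarrow> k \<ge> M \<Longrightarrow> cmod (F n t - F k t) < 1 / Suc q"
        unfolding Cauchy_iff by (meson zero_less_divide_1_iff of_nat_0_less_iff zero_less_Suc)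
      with t show "t \<in> (\<Union>m. A q m)" by (auto simp: A_def intro!: less_imp_le exI[of _ M])
    qed
    show "T' \<in> lmeasurable" by (rule T')
    show "0 < e" by (rule e)
  qed (rule that)
  have "uniform_limit G F \<psi> sequentially"
  proof (rule uniform_limitI)
    fix r :: real assume "0 < r"
    then obtain q where q: "1 / Suc q < r" using nat_approx_posE by blast
    obtain m where m: "G \<subseteq> A q m" using G(4) by blast
    have "dist (F n t) (\<psi> t) \<le> 1 / Suc q" if "n \<ge> m" "t \<in> G" for n t
    proof (rule LIMSEQ_le_const2)
      have "(\<lambda>k. F k t) \<longlonglongrightarrow> \<psi> t"
      proof -
        have "t \<notin> N" "t \<in> {0..1}" using G(2) that T(2) by (auto simp: T'_def)
        then show ?thesis using lim[of t] by simp
      qed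
      then show "(\<lambda>k. dist (F n t) (F k t)) \<longlonglongrightarrow> dist (F n t) (\<psi> t)"
        by (intro tendsto_intros)
      show "\<exists>N. \<forall>k\<ge>N. dist (F n t) (F k t) \<le> 1 / real (Suc q)"
        using m that by (intro exI[of _ m]) (auto simp: A_def dist_norm)
    qed
    then show "\<forall>\<^sub>F n in sequentially. \<forall>t\<in>G. dist (F n t) (\<psi> t) < r"
      using q by (auto simp: eventually_sequentially intro!: exI[of _ m] intro: le_less_trans)
  qed
  moreover have "uniformly_continuous_on G (F n)" for n
  proof -
    have "uniformly_continuous_on {0..1} (F n)"
      by (intro compact_uniformly_continuous continuous_on_subset[OF F]) auto
    moreover have "G \<subseteq> {0..1}" using G(2) T(2) by (auto simp: T'_def)
    ultimately show ?thesis unfolding uniformly_continuous_on_def by (meson subsetD)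
  qed
  ultimately have "uniformly_continuous_on G \<psi>"
    unfolding uniformly_continuous_on_def
  proof (intro allI impI)
    fix r :: real assume lim: "uniform_limit G F \<psi> sequentially"
      and uc: "\<And>n. \<forall>e>0. \<exists>d>0. \<forall>x\<in>G. \<forall>x'\<in>G. dist x' x < d \<longrightarrow> dist (F n x') (F n x) < e"
      and r: "0 < r"
    have "0 < r / 3" using r by simp
    with lim have "\<forall>\<^sub>F n in sequentially. \<forall>x\<in>G. dist (F n x) (\<psi> x) < r / 3"
      by (rule uniform_limitD)
    then obtain n where n: "\<And>x. x \<in> G \<Longrightarrow> dist (F n x) (\<psi> x) < r / 3"
      by (auto simp: eventually_sequentially)
    obtain d where d: "d > 0" "\<And>x x'. x \<in> G \<Longrightarrow> x' \<in> G \<Longrightarrow> dist x' x < d \<Longrightarrow> dist (F n x') (F n x) < r / 3"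
      using uc[of n] \<open>0 < r / 3\<close> by metis
    show "\<exists>d>0. \<forall>x\<in>G. \<forall>x'\<in>G. dist x' x < d \<longrightarrow> dist (\<psi> x') (\<psi> x) < r"
    proof (intro exI[of _ d] conjI d(1) ballI impI)
      fix x x' assume x: "x \<in> G" "x' \<in> G" "dist x' x < d"
      have "dist (\<psi> x') (\<psi> x) \<le> dist (F n x') (\<psi> x') + dist (F n x') (F n x) + dist (F n x) (\<psi> x)"
        by (smt (verit) dist_commute dist_triangle2)
      then show "dist (\<psi> x') (\<psi> x) < r" using n[OF x(1)] n[OF x(2)] d(2)[OF x] by simp
    qed
  qed
  moreover have "measure lebesgue (T - G) \<le> e"
  proof -
    have N': "N \<in> lmeasurable" using N by (simp add: negligible_iff_measure)
    have TG: "T' - G \<in> lmeasurable" by (rule fmeasurable_Diff[OF T' G(1)])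
    have "measure lebesgue (T - G) \<le> measure lebesgue ((T' - G) \<union> N)"
    proof (rule measure_mono_fmeasurable)
      show "T - G \<subseteq> (T' - G) \<union> N" by (auto simp: T'_def)
      show "T - G \<in> sets lebesgue" using T(1) G(1) by auto
      show "(T' - G) \<union> N \<in> lmeasurable" using TG N' by (rule fmeasurable.Un)
    qed
    also have "\<dots> = measure lebesgue (T' - G)"
      using TG N by (intro measure_Un_null_set) (auto simp: negligible_iff_null_sets)
    finally show ?thesis using G by simp
  qed
  ultimately show thesis using that[of G] G by (auto simp: T'_def)
qed

text \<open>An affine majorant is valid at all distances: oscillation below \<open>\<rho>\<close>
  goes into \<open>\<delta>\<close>, and beyond it the crude bound \<open>2 * \<bar>M\<bar>\<close>
  is absorbed by the slope. This is the shape that \<open>sum_modulus_le\<close> can sum.\<close>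

lemma uniformly_continuous_on_modulus:
  fixes \<psi> :: "real \<Rightarrow> complex"
  assumes u: "uniformly_continuous_on G \<psi>" and M: "\<And>t. t \<in> G \<Longrightarrow> cmod (\<psi> t) \<le> M" and d: "0 < \<delta>"
  obtains C where "0 \<le> C" "\<And>s t. s \<in> G \<Longrightarrow> t \<in> G \<Longrightarrow> cmod (\<psi> s - \<psi> t) \<le> \<delta> + C * \<bar>s - t\<bar>"
proof -
  obtain \<rho> where \<rho>: "0 < \<rho>" "\<And>s t. s \<in> G \<Longrightarrow> t \<in> G \<Longrightarrow> \<bar>s - t\<bar> < \<rho> \<Longrightarrow> cmod (\<psi> s - \<psi> t) < \<delta>"
    using u d unfolding uniformly_continuous_on_def dist_norm by (metis real_norm_def)
  show thesis
  proof (rule that[of "2 * \<bar>M\<bar> / \<rho>"])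
    fix s t assume st: "s \<in> G" "t \<in> G"
    show "cmod (\<psi> s - \<psi> t) \<le> \<delta> + 2 * \<bar>M\<bar> / \<rho> * \<bar>s - t\<bar>"
    proof (cases "\<bar>s - t\<bar> < \<rho>")
      case True
      have "0 \<le> 2 * \<bar>M\<bar> / \<rho> * \<bar>s - t\<bar>" using \<rho> by simp
      then show ?thesis using \<rho>(2)[OF st True] by linarith
    next
      case False
      have "cmod (\<psi> s - \<psi> t) \<le> 2 * \<bar>M\<bar>" using norm_triangle_ineq4[of "\<psi> s" "\<psi> t"] M[OF st(1)] M[OF st(2)] by simp
      also have "\<dots> = 2 * \<bar>M\<bar> / \<rho> * \<rho>" using \<rho> by simp
      also have "\<dots> \<le> 2 * \<bar>M\<bar> / \<rho> * \<bar>s - t\<bar>" using False \<rho> by (intro mult_left_mono) auto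
      finally show ?thesis using d by simp
    qed
  qed (use \<rho> in auto)
qed

section \<open>Uniformly good parameters\<close>

context lipschitz_loop
begin

text \<open>Differentiability is expressed by comparing two difference quotients instead of a difference
  quotient and the derivative, so that the condition is closed in t.\<close>
definition flat_at :: "nat \<Rightarrow> nat \<Rightarrow> real \<Rightarrow> bool" where
  "flat_at q m t \<longleftrightarrow> (\<forall>s\<in>{0..1}. \<forall>s'\<in>{0..1}. \<bar>s - t\<bar> < 1 / Suc m \<longrightarrow> \<bar>s' - t\<bar> < 1 / Suc m \<longrightarrow>
     cmod ((g s - g t) * of_real (s' - t) - (g s' - g t) * of_real (s - t)) \<le> \<bar>s - t\<bar> * \<bar>s' - t\<bar> / Suc q)"

text \<open>Combines injectivity and nonvanishing speed at \<open>t\<close> in one quantitative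
  condition that is closed in \<open>t\<close>.\<close>

definition separated_at :: "nat \<Rightarrow> real \<Rightarrow> bool" where
  "separated_at m t \<longleftrightarrow> (\<forall>s\<in>{0..1}. \<bar>s - t\<bar> / Suc m \<le> cmod (g s - g t))"

text \<open>The intersection over \<open>s\<close> and \<open>s'\<close> is uncountable, so
  closedness rather than measurability has to be carried through it. The strict distance premises
  turn into closed alternatives.\<close>

lemma closed_flat_at: "closed {t\<in>{0..1}. flat_at q m t}"
proof -
  have "{t\<in>{0..1}. flat_at q m t} = {0..1} \<inter> (\<Inter>s\<in>{0..1}. \<Inter>s'\<in>{0..1}.
      {t\<in>{0..1}. 1 / Suc m \<le> \<bar>s - t\<bar>} \<union> {t\<in>{0..1}. 1 / Suc m \<le> \<bar>s' - t\<bar>} \<union>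
      {t\<in>{0..1}. cmod ((g s - g t) * of_real (s' - t) - (g s' - g t) * of_real (s - t)) \<le> \<bar>s - t\<bar> * \<bar>s' - t\<bar> / Suc q})"
    unfolding flat_at_def linorder_not_le[symmetric] by blast
  moreover have "closed {t\<in>{0..1}. 1 / Suc m \<le> \<bar>s - t\<bar>}" for s
    by (intro continuous_on_closed_Collect_le continuous_intros closed_atLeastAtMost)
  moreover have "closed {t\<in>{0..1}. cmod ((g s - g t) * of_real (s' - t) - (g s' - g t) * of_real (s - t))
      \<le> \<bar>s - t\<bar> * \<bar>s' - t\<bar> / Suc q}" for s s'
    by (intro continuous_on_closed_Collect_le continuous_intros continuous_g closed_atLeastAtMost) auto
  ultimately show ?thesis by (auto intro!: closed_Int closed_INT closed_Un)
qed

lemma closed_separated_at: "closed {t\<in>{0..1}. separated_at m t}"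
proof -
  have "{t\<in>{0..1}. separated_at m t} =
      {0..1} \<inter> (\<Inter>s\<in>{0..1}. {t\<in>{0..1}. \<bar>s - t\<bar> / Suc m \<le> cmod (g s - g t)})"
    by (auto simp: separated_at_def)
  moreover have "closed {t\<in>{0..1}. \<bar>s - t\<bar> / Suc m \<le> cmod (g s - g t)}" for s
    by (intro continuous_on_closed_Collect_le continuous_intros continuous_g closed_atLeastAtMost) auto
  ultimately show ?thesis by (auto intro!: closed_Int closed_INT)
qed

lemma flat_at_mono: "flat_at q m t \<Longrightarrow> m \<le> n \<Longrightarrow> flat_at q n t"
proof -
  assume "flat_at q m t" "m \<le> n"
  moreover from \<open>m \<le> n\<close> have "1 / real (Suc n) \<le> 1 / real (Suc m)" by (simp add: frac_le)
  ultimately show ?thesis unfolding flat_at_def by (meson less_le_trans)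
qed

lemma separated_at_mono: "separated_at m t \<Longrightarrow> m \<le> n \<Longrightarrow> separated_at n t"
proof -
  assume *: "separated_at m t" "m \<le> n"
  have "\<bar>s - t\<bar> / real (Suc n) \<le> \<bar>s - t\<bar> / real (Suc m)" for s
    using * by (intro divide_left_mono) auto
  with * show ?thesis unfolding separated_at_def by (meson order_trans)
qed

lemma regular_flat_at:
  assumes reg: "regular t v"
  obtains m where "flat_at q m t"
proof -
  have e: "0 < 1 / (2 * real (Suc q))" by simp
  obtain \<rho> where \<rho>: "0 < \<rho>"
    "\<And>s. \<bar>s - t\<bar> < \<rho> \<Longrightarrow> cmod (g s - g t - complex_of_real (s - t) * v) \<le> 1 / (2 * real (Suc q)) * \<bar>s - t\<bar>"
    using regular_approx[OF reg e] by metis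
  obtain m where m: "1 / real (Suc m) < \<rho>" using nat_approx_posE[OF \<rho>(1)] by blast
  have "flat_at q m t"
    unfolding flat_at_def
  proof (intro ballI impI)
    fix s s' :: real
    assume "\<bar>s - t\<bar> < 1 / real (Suc m)" "\<bar>s' - t\<bar> < 1 / real (Suc m)"
    with m have s: "\<bar>s - t\<bar> < \<rho>" "\<bar>s' - t\<bar> < \<rho>" by linarith+
    define E where "E s = g s - g t - complex_of_real (s - t) * v" for s
    have "(g s - g t) * of_real (s' - t) - (g s' - g t) * of_real (s - t) = E s * of_real (s' - t) - E s' * of_real (s - t)"
      by (simp add: E_def algebra_simps)
    also have "cmod \<dots> \<le> cmod (E s) * \<bar>s' - t\<bar> + cmod (E s') * \<bar>s - t\<bar>"
      by (rule order_trans[OF norm_triangle_ineq4]) (simp only: norm_mult norm_of_real)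
    also have "\<dots> \<le> (1 / (2 * real (Suc q)) * \<bar>s - t\<bar>) * \<bar>s' - t\<bar> + (1 / (2 * real (Suc q)) * \<bar>s' - t\<bar>) * \<bar>s - t\<bar>"
      unfolding E_def using \<rho>(2)[OF s(1)] \<rho>(2)[OF s(2)] by (intro add_mono mult_right_mono) auto
    also have "\<dots> = \<bar>s - t\<bar> * \<bar>s' - t\<bar> / Suc q"
      by (simp add: field_simps del: of_nat_Suc)
    finally show "cmod ((g s - g t) * of_real (s' - t) - (g s' - g t) * of_real (s - t)) \<le> \<bar>s - t\<bar> * \<bar>s' - t\<bar> / Suc q" .
  qed
  then show thesis by (rule that)
qed

text \<open>The point \<open>g t\<close> itself lies in every cone at \<open>g t\<close>, so
  \<open>nontangential_separation\<close> applies with \<open>z = g t\<close>.\<close>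

lemma regular_separated_at:
  assumes reg: "regular t v"
  obtains m where "separated_at m t"
proof -
  obtain c r where c: "0 < c" "0 < r"
    "\<And>z s. \<lbrakk>cmod (z - g t) < r; 1 * cmod ((z - g t) / v) \<le> \<bar>Im ((z - g t) / v)\<bar>; s \<in> {0..1}\<rbrakk>
      \<Longrightarrow> c * \<bar>s - t\<bar> \<le> cmod (z - g s)"
    using nontangential_separation[OF reg, of 1] by (metis zero_less_one)
  obtain m where m: "1 / real (Suc m) < c" using nat_approx_posE[OF c(1)] by blast
  have "separated_at m t"
    unfolding separated_at_def
  proof
    fix s :: real assume s: "s \<in> {0..1}"
    have "\<bar>s - t\<bar> / Suc m = 1 / Suc m * \<bar>s - t\<bar>" by simp
    also have "\<dots> \<le> c * \<bar>s - t\<bar>" using m by (intro mult_right_mono) auto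
    also have "\<dots> \<le> cmod (g s - g t)" using c(2) c(3)[of "g t" s] s by (simp add: norm_minus_commute)
    finally show "\<bar>s - t\<bar> / Suc m \<le> cmod (g s - g t)" .
  qed
  then show thesis by (rule that)
qed

text \<open>Take as second parameter \<open>t + d\<close> with \<open>d\<close> so small, depending
  on \<open>t\<close>, that its quotient is within \<open>1 / Suc q\<close> of the derivative. Since
  \<open>d\<close> cancels, the bound holds on the whole window \<open>1 / Suc m\<close>; the two
  errors add up to the factor 2.\<close>

lemma flat_at_regular:
  assumes flat: "flat_at q m t" and reg: "regular t v" and s: "s \<in> {0..1}" "\<bar>s - t\<bar> < 1 / Suc m"
  shows "cmod (g s - g t - complex_of_real (s - t) * v) \<le> 2 / Suc q * \<bar>s - t\<bar>"
proof -
  note t = regularD[OF reg]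
  have e: "0 < 1 / real (Suc q)" by simp
  obtain \<rho> where \<rho>: "0 < \<rho>"
    "\<And>s. \<bar>s - t\<bar> < \<rho> \<Longrightarrow> cmod (g s - g t - complex_of_real (s - t) * v) \<le> 1 / real (Suc q) * \<bar>s - t\<bar>"
    using regular_approx[OF reg e] by metis
  define M where "M = min (min \<rho> (1 / Suc m)) (1 - t)"
  define d where "d = M / 2"
  have M: "0 < M" "M \<le> \<rho>" "M \<le> 1 / Suc m" "M \<le> 1 - t"
    using \<rho>(1) t by (simp_all add: M_def)
  then have d: "0 < d" "d < \<rho>" "d < 1 / Suc m" "d \<le> 1 - t"
    by (simp_all add: d_def del: of_nat_Suc)
  define E where "E s = g s - g t - complex_of_real (s - t) * v" for s
  have "cmod ((g s - g t) * of_real d - (g (t + d) - g t) * of_real (s - t)) \<le> \<bar>s - t\<bar> * d / Suc q"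
    using flat[unfolded flat_at_def, rule_format, of s "t + d"] s d t by simp
  also have "(g s - g t) * of_real d - (g (t + d) - g t) * of_real (s - t) = E s * of_real d - E (t + d) * of_real (s - t)"
    by (simp add: E_def algebra_simps)
  finally have "cmod (E s * of_real d - E (t + d) * of_real (s - t)) \<le> \<bar>s - t\<bar> * d / Suc q" .
  moreover have "cmod (E s * of_real d) \<le> cmod (E s * of_real d - E (t + d) * of_real (s - t)) + cmod (E (t + d) * of_real (s - t))"
    by (metis add.commute norm_triangle_sub)
  moreover have "cmod (E (t + d) * of_real (s - t)) \<le> (1 / Suc q * d) * \<bar>s - t\<bar>"
    unfolding norm_mult norm_of_real using \<rho>(2)[of "t + d"] d by (intro mult_right_mono) (auto simp: E_def)
  moreover have "2 / Suc q * \<bar>s - t\<bar> * d = \<bar>s - t\<bar> * d / Suc q + (1 / Suc q * d) * \<bar>s - t\<bar>"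
    by (simp add: field_simps del: of_nat_Suc)
  moreover have "cmod (E s * of_real d) = cmod (E s) * d" using d by (simp add: norm_mult)
  ultimately have "cmod (E s) * d \<le> 2 / Suc q * \<bar>s - t\<bar> * d" by linarith
  from this d(1) show ?thesis unfolding E_def by (rule mult_right_le_imp_le)
qed

text \<open>\<open>egorov_sets\<close> makes flatness and separation uniform together, and Lusin's
  theorem takes care of \<open>\<psi>\<close>. The measurable set \<open>T\<close> contains every
  regular parameter, so \<open>B\<close> catches all regular ones that are lost.\<close>

lemma uniformly_good_set:
  assumes meas: "\<psi> \<in> borel_measurable (lebesgue_on {0..1})" and e: "0 < \<epsilon>"
  obtains G B c where "B \<in> lmeasurable" "measure lebesgue B \<le> \<epsilon>"
    "\<And>t v. regular t v \<Longrightarrow> t \<in> G \<or> t \<in> B" "G \<subseteq> {0<..<1}" "uniformly_continuous_on G (\<psi> :: real \<Rightarrow> complex)"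
    "0 < c" "\<And>s t. t \<in> G \<Longrightarrow> s \<in> {0..1} \<Longrightarrow> c * \<bar>s - t\<bar> \<le> cmod (g s - g t)"
    "\<And>\<delta>. 0 < \<delta> \<Longrightarrow> \<exists>\<rho>>0. \<forall>s t v. t \<in> G \<longrightarrow> regular t v \<longrightarrow> s \<in> {0..1} \<longrightarrow> \<bar>s - t\<bar> < \<rho> \<longrightarrow>
        cmod (g s - g t - complex_of_real (s - t) * v) \<le> \<delta> * \<bar>s - t\<bar>"
proof -
  define A where "A q m = {t\<in>{0..1}. flat_at q m t} \<inter> {t\<in>{0..1}. separated_at m t}" for q m
  define T where "T = {0<..<1} \<inter> (\<Inter>q. \<Union>m. A q m)"
  have A_sets: "A q m \<in> sets lebesgue" for q m
    unfolding A_def by (intro sets_completionI_sets[of _ lborel])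
      (simp only: sets_lborel borel_closed[OF closed_Int[OF closed_flat_at closed_separated_at]])
  have "T \<in> sets lebesgue"
    unfolding T_def by (intro sets.Int sets.countable_INT sets.countable_UN) (use A_sets in auto)
  then have T: "T \<in> lmeasurable"
    by (rule bounded_set_imp_lmeasurable[rotated])
      (rule bounded_subset[OF bounded_closed_interval[of 0 1]], auto simp: T_def)
  have T01: "T \<subseteq> {0..1}" by (auto simp: T_def)
  have reg_T: "t \<in> T" if reg: "regular t v" for t v
  proof -
    have "\<exists>m. t \<in> A q m" for q
    proof -
      obtain m where m: "flat_at q m t" using regular_flat_at[OF reg] .
      obtain n where n: "separated_at n t" using regular_separated_at[OF reg] .
      have "t \<in> A q (max m n)"
        using flat_at_mono[OF m] separated_at_mono[OF n] regularD[OF reg] by (auto simp: A_def)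
      then show ?thesis ..
    qed
    then show ?thesis using regularD[OF reg] by (auto simp: T_def)
  qed
  have e2: "0 < \<epsilon> / 2" using e by simp
  obtain G1 where G1: "G1 \<in> sets lebesgue" "G1 \<subseteq> T" "measure lebesgue (T - G1) \<le> \<epsilon> / 2" "\<And>q. \<exists>m. G1 \<subseteq> A q m"
  proof (rule egorov_sets[OF T A_sets _ _ e2])
    show "A q m \<subseteq> A q n" if "m \<le> n" for q m n
      using flat_at_mono separated_at_mono that by (auto simp: A_def)
    show "T \<subseteq> (\<Union>m. A q m)" for q by (auto simp: T_def)
  qed (rule that)
  obtain G2 where G2: "G2 \<in> sets lebesgue" "G2 \<subseteq> T" "measure lebesgue (T - G2) \<le> \<epsilon> / 2" "uniformly_continuous_on G2 \<psi>"
    using lusin_uniformly_continuous[OF meas T T01 e2] .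
  define G where "G = G1 \<inter> G2"
  define B where "B = (T - G1) \<union> (T - G2)"
  have TG: "T - G1 \<in> lmeasurable" "T - G2 \<in> lmeasurable"
    using fmeasurable_Diff[OF T] G1(1) G2(1) by auto
  \<comment> \<open>Separation does not involve the precision, so the threshold for
    \<open>q = 0\<close> fixes \<open>c\<close>.\<close>
  obtain m where m: "G1 \<subseteq> A 0 m" using G1(4) by blast
  show thesis
  proof (rule that[of B G "1 / Suc m"])
    show "B \<in> lmeasurable" unfolding B_def using TG by (rule fmeasurable.Un)
    have "measure lebesgue B \<le> measure lebesgue (T - G1) + measure lebesgue (T - G2)"
      unfolding B_def using TG by (intro measure_Un_le) auto
    then show "measure lebesgue B \<le> \<epsilon>" using G1(3) G2(3) by simp
    show "t \<in> G \<or> t \<in> B" if "regular t v" for t v using reg_T[OF that] by (auto simp: G_def B_def)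
    show "G \<subseteq> {0<..<1}" using G1(2) by (auto simp: G_def T_def)
    show "uniformly_continuous_on G \<psi>" 
      using G2(4) unfolding uniformly_continuous_on_def G_def by (meson IntD2)
    show "0 < 1 / real (Suc m)" by simp
    show "1 / real (Suc m) * \<bar>s - t\<bar> \<le> cmod (g s - g t)" if "t \<in> G" "s \<in> {0..1}" for s t
      using m that by (auto simp: G_def A_def separated_at_def)
    fix \<delta> :: real assume "0 < \<delta>"
    then have "0 < \<delta> / 2" by simp
    then obtain q where q: "1 / real (Suc q) < \<delta> / 2" using nat_approx_posE by blast
    obtain n where n: "G1 \<subseteq> A q n" using G1(4) by blast
    show "\<exists>\<rho>>0. \<forall>s t v. t \<in> G \<longrightarrow> regular t v \<longrightarrow> s \<in> {0..1} \<longrightarrow> \<bar>s - t\<bar> < \<rho> \<longrightarrow>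
        cmod (g s - g t - complex_of_real (s - t) * v) \<le> \<delta> * \<bar>s - t\<bar>"
    proof (intro exI[of _ "1 / real (Suc n)"] conjI allI impI)
      fix s t v assume *: "t \<in> G" "regular t v" "s \<in> {0..1}" "\<bar>s - t\<bar> < 1 / real (Suc n)"
      have "flat_at q n t" using n * by (auto simp: G_def A_def)
      from flat_at_regular[OF this *(2-4)]
      have "cmod (g s - g t - complex_of_real (s - t) * v) \<le> 2 / real (Suc q) * \<bar>s - t\<bar>" .
      also have "\<dots> \<le> \<delta> * \<bar>s - t\<bar>" using q by (intro mult_right_mono) auto
      finally show "cmod (g s - g t - complex_of_real (s - t) * v) \<le> \<delta> * \<bar>s - t\<bar>" .
    qed simp
  qed
qed

section \<open>The correction step\<close>

lemma regular_speed_le: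
  assumes reg: "regular t v"
  shows "cmod v \<le> L"
proof (rule field_le_epsilon)
  fix e :: real assume e: "0 < e"
  note t = regularD[OF reg]
  obtain \<rho> where \<rho>: "0 < \<rho>"
    "\<And>s. \<bar>s - t\<bar> < \<rho> \<Longrightarrow> cmod (g s - g t - complex_of_real (s - t) * v) \<le> e * \<bar>s - t\<bar>"
    using regular_approx[OF reg e] by metis
  define M where "M = min \<rho> (1 - t)"
  define d where "d = M / 2"
  have "0 < M" "M \<le> \<rho>" "M \<le> 1 - t" using \<rho>(1) t by (simp_all add: M_def)
  then have d: "0 < d" "d < \<rho>" "t + d \<le> 1" by (simp_all add: d_def)
  have "cmod (complex_of_real d * v) \<le> cmod (g (t + d) - g t) + cmod (g (t + d) - g t - complex_of_real d * v)"
    by (metis add.commute norm_triangle_sub norm_minus_commute)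
  also have "\<dots> \<le> L * d + e * d"
    using lip[of "t + d" t] \<rho>(2)[of "t + d"] d t by (intro add_mono) auto
  finally have "cmod v * d \<le> (L + e) * d" using d by (simp add: norm_mult algebra_simps)
  from this d(1) show "cmod v \<le> L + e" by (rule mult_right_le_imp_le)
qed

lemma regular_speed_ge:
  assumes reg: "regular t v" and sep: "\<And>s. s \<in> {0..1} \<Longrightarrow> c * \<bar>s - t\<bar> \<le> cmod (g s - g t)"
  shows "c \<le> cmod v"
proof (rule field_le_epsilon)
  fix e :: real assume e: "0 < e"
  note t = regularD[OF reg]
  obtain \<rho> where \<rho>: "0 < \<rho>"
    "\<And>s. \<bar>s - t\<bar> < \<rho> \<Longrightarrow> cmod (g s - g t - complex_of_real (s - t) * v) \<le> e * \<bar>s - t\<bar>"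
    using regular_approx[OF reg e] by metis
  define M where "M = min \<rho> (1 - t)"
  define d where "d = M / 2"
  have "0 < M" "M \<le> \<rho>" "M \<le> 1 - t" using \<rho>(1) t by (simp_all add: M_def)
  then have d: "0 < d" "d < \<rho>" "t + d \<le> 1" by (simp_all add: d_def)
  have "c * d \<le> cmod (g (t + d) - g t)" using sep[of "t + d"] d t by simp
  also have "\<dots> \<le> cmod (complex_of_real d * v) + cmod (g (t + d) - g t - complex_of_real d * v)"
    by (rule norm_triangle_sub)
  also have "\<dots> \<le> cmod v * d + e * d"
    using \<rho>(2)[of "t + d"] d by (intro add_mono) (auto simp: norm_mult)
  finally have "c * d \<le> (cmod v + e) * d" by (simp add: algebra_simps)
  from this d(1) show "c \<le> cmod v + e" by (rule mult_right_le_imp_le)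
qed

text \<open>The correction is a sum of dipoles, each with one pole on the curve and one just outside it,
  whose real part on the (nearly straight) curve is that of a Poisson kernel at scale 1/N.\<close>
lemma correction_step:
  fixes r :: "real \<Rightarrow> real" and \<nu> :: "real \<Rightarrow> complex"
  assumes unit: "\<And>t. t \<in> {0..1} \<Longrightarrow> cmod (\<nu> t) = 1"
    and meas: "r \<in> borel_measurable (lebesgue_on {0..1})" "\<nu> \<in> borel_measurable (lebesgue_on {0..1})"
    and kappa: "0 < \<kappa>" "\<kappa> \<le> 1" and K: "compact K" "K \<subseteq> D"
  obtains f :: "complex \<Rightarrow> complex" and P B where
    "finite P" "P \<inter> D = {}" "f holomorphic_on - P" "f \<in> borel_measurable borel"
    "B \<in> lmeasurable" "measure lebesgue B \<le> \<kappa>"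
    "\<And>z. z \<in> K \<Longrightarrow> cmod (f z) \<le> \<kappa>"
    "\<And>t v. regular t v \<Longrightarrow> t \<notin> B \<Longrightarrow> \<bar>r t - Re (cnj (\<nu> t) * f (g t))\<bar> \<le> 39/40 * \<bar>r t\<bar> + \<kappa>\<^sup>2"
    "\<And>t v z c. \<lbrakk>regular t v; t \<notin> B; z \<in> D; 0 < c; c \<le> 1;
        \<And>s. s \<in> {0..1} \<Longrightarrow> c * L * \<bar>s - t\<bar> \<le> cmod (z - g s)\<rbrakk> \<Longrightarrow> cmod (f z) \<le> (12 * \<bar>r t\<bar> / \<kappa> + \<kappa>) / c\<^sup>2"
proof -
  define \<psi> where "\<psi> t = complex_of_real (r t) * \<nu> t" for t
  have psi_meas: "\<psi> \<in> borel_measurable (lebesgue_on {0..1})"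
    unfolding \<psi>_def using meas by (intro borel_measurable_times borel_measurable_of_real) auto
  have norm_psi: "cmod (\<psi> t) = \<bar>r t\<bar>" if "t \<in> {0..1}" for t
    using unit[OF that] by (simp add: \<psi>_def norm_mult)
  have "0 < \<kappa> / 2" using kappa by simp
  obtain G B0 c0 where B0: "B0 \<in> lmeasurable" "measure lebesgue B0 \<le> \<kappa> / 2"
    and GB: "\<And>t v. regular t v \<Longrightarrow> t \<in> G \<or> t \<in> B0" and G01: "G \<subseteq> {0<..<1}"
    and psi_uc: "uniformly_continuous_on G \<psi>"
    and c0: "0 < c0" and sep: "\<And>s t. t \<in> G \<Longrightarrow> s \<in> {0..1} \<Longrightarrow> c0 * \<bar>s - t\<bar> \<le> cmod (g s - g t)"
    and flat: "\<And>\<delta>. 0 < \<delta> \<Longrightarrow> \<exists>\<rho>>0. \<forall>s t v. t \<in> G \<longrightarrow> regular t v \<longrightarrow> s \<in> {0..1} \<longrightarrow> \<bar>s - t\<bar> < \<rho> \<longrightarrow>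
        cmod (g s - g t - complex_of_real (s - t) * v) \<le> \<delta> * \<bar>s - t\<bar>"
    by (rule uniformly_good_set[OF psi_meas \<open>0 < \<kappa> / 2\<close>]) (rule that)
  have "bounded G" using G01 by (rule bounded_subset[rotated]) auto
  with psi_uc have "bounded (\<psi> ` G)" by (rule bounded_uniformly_continuous_image)
  then obtain M where M: "0 < M" "\<And>t. t \<in> G \<Longrightarrow> cmod (\<psi> t) \<le> M"
    unfolding bounded_pos by auto
  \<comment> \<open>The separation constant in units of \<open>L\<close>, so that dividing by a
    tangent vector of length at most \<open>L\<close> leaves the bare constant.\<close>
  define cc where "cc = min 1 (c0 / L)"
  have cc: "0 < cc" "cc \<le> 1" "cc * L \<le> c0"
  proof -
    show "0 < cc" "cc \<le> 1" using c0 L_pos by (auto simp: cc_def)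
    have "cc * L \<le> c0 / L * L" using L_pos by (intro mult_right_mono) (auto simp: cc_def)
    then show "cc * L \<le> c0" using L_pos by simp
  qed
  obtain \<rho>1 where \<rho>1: "0 < \<rho>1"
    "\<And>s t v. \<lbrakk>t \<in> G; regular t v; s \<in> {0..1}; \<bar>s - t\<bar> < \<rho>1\<rbrakk> \<Longrightarrow>
        cmod (g s - g t - complex_of_real (s - t) * v) \<le> c0 / 4 * \<bar>s - t\<bar>"
    using flat[of "c0 / 4"] c0 by auto
  \<comment> \<open>Within distance \<open>R\<close> of \<open>g t\<close>, separation forces
    \<open>\<bar>s - t\<bar> < \<rho>1\<close>. There the deviation from the tangent is at most a
    quarter, which keeps the curve out of the cone with constant 1/2.\<close>
  define R where "R = c0 * \<rho>1"
  have R: "0 < R" using c0 \<rho>1(1) by (simp add: R_def)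
  have speed: "c0 \<le> cmod v" "cmod v \<le> L" if "regular t v" "t \<in> G" for t v
    using regular_speed_ge[OF that(1), of c0] sep[OF that(2)] regular_speed_le[OF that(1)] by auto
  define G' where "G' = {t \<in> G. \<exists>v. regular t v}"
  have "\<exists>v u. regular t v \<and> (u = v \<or> u = - v) \<and> (\<forall>z. z \<in> D \<union> path_image g \<longrightarrow> cmod (z - g t) < R \<longrightarrow>
      - (1 / 2) * cmod ((z - g t) / u) \<le> Im ((z - g t) / u))" if t: "t \<in> G'" for t
  proof -
    obtain v where reg: "regular t v" and tG: "t \<in> G" using t by (auto simp: G'_def)
    have v: "c0 \<le> cmod v" by (rule speed[OF reg tG])
    obtain u where "u = v \<or> u = - v"
      "\<And>z. \<lbrakk>z \<in> D \<union> path_image g; cmod (z - g t) < R\<rbrakk> \<Longrightarrow> - (1 / 2) * cmod ((z - g t) / u) \<le> Im ((z - g t) / u)"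
    proof (rule one_side_outside[OF reg R])
      fix z assume z: "0 < cmod (z - g t)" "cmod (z - g t) < R"
        and cone: "1 / 2 * cmod ((z - g t) / v) < \<bar>Im ((z - g t) / v)\<bar>"
      show "z \<notin> path_image g"
      proof
        assume "z \<in> path_image g"
        then obtain s where s: "s \<in> {0..1}" "z = g s" by (auto simp: path_image_def)
        have "c0 * \<bar>s - t\<bar> < c0 * \<rho>1" using sep[OF tG s(1)] z s by (simp add: R_def)
        then have "\<bar>s - t\<bar> < \<rho>1" using c0 by simp
        from \<rho>1(2)[OF tG reg s(1) this]
        have "cmod (z - g t - complex_of_real (s - t) * v) \<le> c0 / 4 * \<bar>s - t\<bar>" using s by simp
        also have "\<dots> \<le> \<bar>s - t\<bar> / 4 * cmod v" using mult_left_mono[OF v, of "\<bar>s - t\<bar>"] by (simp add: algebra_simps)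
        finally have "cmod (z - g t - complex_of_real (s - t) * v) / cmod v \<le> \<bar>s - t\<bar> / 4"
          using v c0 by (subst pos_divide_le_eq) auto
        moreover have "(z - g t) / v - of_real (s - t) = (z - g t - of_real (s - t) * v) / v"
          using regularD(3)[OF reg] by (simp add: diff_divide_distrib)
        ultimately have *: "cmod ((z - g t) / v - of_real (s - t)) \<le> \<bar>s - t\<bar> / 4"
          by (simp only: norm_divide)
        have "\<bar>Im ((z - g t) / v - of_real (s - t))\<bar> \<le> \<bar>s - t\<bar> / 4"
          by (rule order_trans[OF abs_Im_le_cmod *])
        moreover have "cmod (of_real (s - t)) \<le> cmod ((z - g t) / v) + cmod ((z - g t) / v - of_real (s - t))"
          by (metis norm_minus_commute norm_triangle_sub)
        ultimately show False using cone * by (simp del: of_real_diff)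
      qed
    qed blast
    with reg show ?thesis by blast
  qed
  then obtain V U where reg_V: "\<And>t. t \<in> G' \<Longrightarrow> regular t (V t)"
    and UV: "\<And>t. t \<in> G' \<Longrightarrow> U t = V t \<or> U t = - V t"
    and side: "\<And>t z. \<lbrakk>t \<in> G'; z \<in> D \<union> path_image g; cmod (z - g t) < R\<rbrakk> \<Longrightarrow>
      - (1 / 2) * cmod ((z - g t) / U t) \<le> Im ((z - g t) / U t)"
    by metis
  have G'G: "t \<in> G" if "t \<in> G'" for t using that by (auto simp: G'_def)
  have U: "c0 \<le> cmod (U t)" "cmod (U t) \<le> L" "U t \<noteq> 0" if "t \<in> G'" for t
    using speed[OF reg_V[OF that] G'G[OF that]] UV[OF that] c0 by auto
  \<comment> \<open>At most \<open>N\<close> excised intervals of length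
    \<open>2 * \<kappa>' / N\<close> cost \<open>\<kappa> / 2\<close>; the other half is the set
    lost in \<open>uniformly_good_set\<close>.\<close>
  define \<kappa>' where "\<kappa>' = \<kappa> / 4"
  have kappa': "0 < \<kappa>'" "\<kappa>' \<le> 1" using kappa by (auto simp: \<kappa>'_def)
  define Q where "Q = 18 / \<kappa>'"
  have Q: "0 < Q" "Q = 72 / \<kappa>" using kappa by (auto simp: Q_def \<kappa>'_def)
  \<comment> \<open>Price per dipole of the two approximations made on the curve: the first term is
    for freezing the density at \<open>\<psi> t\<close>, the second for straightening the
    curve.\<close>
  define W where "W = 3 / cc\<^sup>2 + 12 * M / (c0 * cc\<^sup>2)"
  have W: "1 \<le> W"
  proof -
    have "cc\<^sup>2 \<le> 1" using cc by (simp add: power_le_one)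
    then have "1 \<le> 3 / cc\<^sup>2" using cc by (simp add: field_simps)
    moreover have "0 \<le> 12 * M / (c0 * cc\<^sup>2)" using M c0 by simp
    ultimately show ?thesis by (simp add: W_def)
  qed
  \<comment> \<open>Makes the accumulated error \<open>W * \<eta>\<close> the permitted
    \<open>\<kappa>\<^sup>2\<close>, with \<open>\<eta> \<le> \<kappa>\<close> for the estimate in
    cones.\<close>
  define \<eta> where "\<eta> = \<kappa>\<^sup>2 / W"
  have eta: "0 < \<eta>" "\<eta> \<le> \<kappa>" "W * \<eta> = \<kappa>\<^sup>2"
  proof -
    show "0 < \<eta>" "W * \<eta> = \<kappa>\<^sup>2" using W kappa by (auto simp: \<eta>_def)
    have "\<kappa>\<^sup>2 / W \<le> \<kappa>\<^sup>2 / 1" using W by (intro divide_left_mono) auto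
    also have "\<kappa>\<^sup>2 / 1 \<le> \<kappa>" using kappa by (simp add: power2_eq_square mult_left_le)
    finally show "\<eta> \<le> \<kappa>" by (simp add: \<eta>_def)
  qed
  define \<delta> where "\<delta> = \<eta> / (2 * Q)"
  have delta: "0 < \<delta>" "Q * \<delta> = \<eta> / 2" using eta Q by (auto simp: \<delta>_def)
  obtain C1 where C1: "0 \<le> C1" "\<And>s t. s \<in> G \<Longrightarrow> t \<in> G \<Longrightarrow> cmod (\<psi> s - \<psi> t) \<le> \<delta> + C1 * \<bar>s - t\<bar>"
    using uniformly_continuous_on_modulus[OF psi_uc M(2) delta(1)] by metis
  obtain \<rho>2 where \<rho>2: "0 < \<rho>2"
    "\<And>s t v. \<lbrakk>t \<in> G; regular t v; s \<in> {0..1}; \<bar>s - t\<bar> < \<rho>2\<rbrakk> \<Longrightarrow>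
        cmod (g s - g t - complex_of_real (s - t) * v) \<le> \<delta> * \<bar>s - t\<bar>"
    using flat[of \<delta>] delta by auto
  \<comment> \<open>The larger slope lets one modulus control also the deviation from the tangent:
    beyond \<open>\<rho>2\<close> the Lipschitz bound \<open>2 * L * \<bar>s - t\<bar>\<close> is at
    most \<open>2 * L / \<rho>2 * \<bar>s - t\<bar>\<^sup>2\<close>.\<close>
  define C where "C = max C1 (2 * L / \<rho>2)"
  have C: "0 \<le> C" using C1 by (auto simp: C_def)
  have psi_mod: "cmod (\<psi> s - \<psi> t) \<le> \<delta> + C * \<bar>s - t\<bar>" if "s \<in> G" "t \<in> G" for s t
  proof -
    have "C1 * \<bar>s - t\<bar> \<le> C * \<bar>s - t\<bar>" by (intro mult_right_mono) (auto simp: C_def)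
    with C1(2)[OF that] show ?thesis by linarith
  qed
  have g_mod: "cmod (g s - g t - complex_of_real (s - t) * v) \<le> (\<delta> + C * \<bar>s - t\<bar>) * \<bar>s - t\<bar>"
    if "t \<in> G" "regular t v" "s \<in> {0..1}" for s t v
  proof (cases "\<bar>s - t\<bar> < \<rho>2")
    case True
    have "\<delta> * \<bar>s - t\<bar> \<le> (\<delta> + C * \<bar>s - t\<bar>) * \<bar>s - t\<bar>" using C by (intro mult_right_mono) auto
    with \<rho>2(2)[OF that True] show ?thesis by linarith
  next
    case False
    have "cmod (g s - g t - complex_of_real (s - t) * v) \<le> cmod (g s - g t) + cmod (complex_of_real (s - t) * v)"
      by (rule norm_triangle_ineq4)
    also have "\<dots> \<le> L * \<bar>s - t\<bar> + \<bar>s - t\<bar> * L"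
    proof (rule add_mono)
      show "cmod (g s - g t) \<le> L * \<bar>s - t\<bar>" using lip[of s t] that(3) regularD[OF that(2)] by simp
      show "cmod (complex_of_real (s - t) * v) \<le> \<bar>s - t\<bar> * L"
        unfolding norm_mult norm_of_real by (intro mult_left_mono speed[OF that(2,1)]) auto
    qed
    also have "\<dots> = (2 * L / \<rho>2 * \<rho>2) * \<bar>s - t\<bar>" using \<rho>2(1) by simp
    also have "\<dots> \<le> (C * \<bar>s - t\<bar>) * \<bar>s - t\<bar>"
      using False \<rho>2(1) L_pos C by (intro mult_right_mono mult_mono) (auto simp: C_def)
    also have "\<dots> \<le> (\<delta> + C * \<bar>s - t\<bar>) * \<bar>s - t\<bar>" using delta by (intro mult_right_mono) auto
    finally show ?thesis .
  qed
  obtain d where d: "0 < d" "\<And>z \<zeta>. z \<in> K \<Longrightarrow> \<zeta> \<in> path_image g \<Longrightarrow> d \<le> dist z \<zeta>"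
    using separate_compact_closed[OF K(1) closed_path_image[OF path_g]] K(2) D_disjoint by blast
  \<comment> \<open>One summand per demand on the mesh: the error term of
    \<open>sum_modulus_le\<close>; scaled distance 2 where the side condition ends at radius
    \<open>R\<close>; scaled distance 2 for points of \<open>K\<close>; smallness on
    \<open>K\<close>.\<close>
  define N0 where "N0 = (2 * C * (1 + Q) / \<eta>)\<^sup>2 + 2 * L / R + 2 * L / d + 3 * M * L\<^sup>2 / (d\<^sup>2 * \<kappa>)"
  obtain N :: nat where N_gt: "N0 < real N" using reals_Archimedean2 by blast
  have parts: "0 \<le> (2 * C * (1 + Q) / \<eta>)\<^sup>2" "0 < 2 * L / R" "0 < 2 * L / d" "0 \<le> 3 * M * L\<^sup>2 / (d\<^sup>2 * \<kappa>)"
    using R d L_pos M kappa by simp_all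
  have "0 < real N" using N_gt parts unfolding N0_def by linarith
  then have N: "0 < N" by simp
  have N_R: "2 * L \<le> real N * R" and N_d: "2 * L \<le> real N * d"
  proof -
    have "2 * L / R \<le> real N" "2 * L / d \<le> real N" using N_gt parts unfolding N0_def by linarith+
    then show "2 * L \<le> real N * R" "2 * L \<le> real N * d" using R d by (simp_all add: field_simps)
  qed
  have N_K: "3 * M * L\<^sup>2 / (d\<^sup>2 * real N) \<le> \<kappa>"
  proof -
    have "3 * M * L\<^sup>2 / (d\<^sup>2 * \<kappa>) \<le> real N" using N_gt parts unfolding N0_def by linarith
    then show ?thesis using N d kappa by (simp add: field_simps)
  qed
  have N_eta: "C * (1 + Q) / sqrt (real N) \<le> \<eta> / 2"
  proof -
    have "(2 * C * (1 + Q) / \<eta>)\<^sup>2 \<le> real N" using N_gt parts unfolding N0_def by linarith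
    then have "2 * C * (1 + Q) / \<eta> \<le> sqrt (real N)" by (rule real_le_rsqrt)
    then show ?thesis using N eta by (simp add: field_simps)
  qed
  define I where "I = {j. j < N \<and> (\<exists>t\<in>G'. real j / N \<le> t \<and> t \<le> (real j + 1) / N)}"
  have fin: "finite I" and cardI: "card I \<le> N"
  proof -
    have "I \<subseteq> {..<N}" by (auto simp: I_def)
    then show "finite I" "card I \<le> N" using finite_subset card_mono[of "{..<N}" I] by auto
  qed
  have "\<forall>j\<in>I. \<exists>t. t \<in> G' \<and> real j / N \<le> t \<and> t \<le> (real j + 1) / N" by (auto simp: I_def)
  then obtain \<tau> where \<tau>: "\<And>j. j \<in> I \<Longrightarrow> \<tau> j \<in> G'"
    "\<And>j. j \<in> I \<Longrightarrow> real j / N \<le> \<tau> j \<and> \<tau> j \<le> (real j + 1) / N"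
    by metis
  have \<tau>N: "real j \<le> N * \<tau> j" "N * \<tau> j \<le> real j + 1" if "j \<in> I" for j
    using \<tau>(2)[OF that] N by (auto simp: field_simps)
  have \<tau>G: "\<tau> j \<in> G" if "j \<in> I" for j using G'G \<tau>(1) that by blast
  have \<tau>01: "\<tau> j \<in> {0..1}" if "j \<in> I" for j using \<tau>G[OF that] G01 by auto
  \<comment> \<open>The rescaled coordinate at a sample: the curve is nearly the real axis, cells
    have unit parameter length, and the second pole lies at \<open>- \<i>\<close>, on the outer
    side.\<close>
  define w where "w j z = complex_of_real (real N) * (z - g (\<tau> j)) / U (\<tau> j)" for j z
  \<comment> \<open>The density contains \<open>\<nu>\<close>, which \<open>cnj (\<nu> t)\<close>
    cancels up to a small error; what remains is \<open>r t / 20\<close> times a sum bounded by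
    \<open>sum_poisson_le\<close>.\<close>
  define f where "f z = (1 / 20) * (\<Sum>j\<in>I. \<psi> (\<tau> j) * kern (w j z))" for z
  define P where "P = (\<Union>j\<in>I. {g (\<tau> j), g (\<tau> j) - \<i> * U (\<tau> j) / complex_of_real (real N)})"
  define B where "B = B0 \<union> (\<Union>j\<in>I. {\<tau> j - \<kappa>' / N .. \<tau> j + \<kappa>' / N})"
  have w_scale: "w j z = of_real (real N) * ((z - g (\<tau> j)) / U (\<tau> j))" for j z by (simp add: w_def)
  have norm_w: "cmod (w j z) = real N * cmod (z - g (\<tau> j)) / cmod (U (\<tau> j))" for j z
    by (simp add: w_def norm_mult norm_divide)
  have w_ge: "real N * cmod (z - g (\<tau> j)) / L \<le> cmod (w j z)" if "j \<in> I" for j z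
    unfolding norm_w using U[OF \<tau>(1)[OF that]] L_pos c0
    by (intro divide_left_mono mult_pos_pos mult_nonneg_nonneg) auto
  \<comment> \<open>Near the sample the orientation of \<open>U\<close> keeps \<open>z\<close> out
    of the cone around the second pole; beyond \<open>R\<close> the mesh is fine enough for
    \<open>norm_add_ii_ge_far\<close>.\<close>
  have shift: "(1 + cmod (w j z)) / 3 \<le> cmod (w j z + \<i>)" if j: "j \<in> I" and z: "z \<in> D \<union> path_image g" for j z
  proof (cases "cmod (z - g (\<tau> j)) < R")
    case True
    define \<zeta> where "\<zeta> = (z - g (\<tau> j)) / U (\<tau> j)"
    have "real N * (- (1 / 2) * cmod \<zeta>) \<le> real N * Im \<zeta>"
      using side[OF \<tau>(1)[OF j] z True] unfolding \<zeta>_def by (intro mult_left_mono) auto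
    moreover have "w j z = of_real (real N) * \<zeta>" unfolding \<zeta>_def by (rule w_scale)
    ultimately have "- (1 / 2) * cmod (w j z) \<le> Im (w j z)" by (simp add: norm_mult)
    then show ?thesis by (rule norm_add_ii_ge_cone)
  next
    case False
    have "2 * L \<le> real N * cmod (z - g (\<tau> j))"
      using N_R False by (smt (verit) mult_left_mono of_nat_0_le_iff)
    then have "2 \<le> real N * cmod (z - g (\<tau> j)) / L" using L_pos by (simp add: field_simps)
    also note w_ge[OF j]
    finally show ?thesis by (rule norm_add_ii_ge_far)
  qed
  have w_nz: "w j z \<noteq> 0" "w j z + \<i> \<noteq> 0" if j: "j \<in> I" and z: "z \<notin> P" for j z
  proof -
    have U0: "U (\<tau> j) \<noteq> 0" using U(3)[OF \<tau>(1)[OF j]] .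
    have *: "z = g (\<tau> j) + w j z * U (\<tau> j) / of_real (real N)" using U0 N by (simp add: w_def)
    show "w j z \<noteq> 0" using * j z by (force simp: P_def)
    show "w j z + \<i> \<noteq> 0"
    proof
      assume "w j z + \<i> = 0"
      then have "w j z = - \<i>" by (simp add: eq_neg_iff_add_eq_0)
      with * have "z = g (\<tau> j) - \<i> * U (\<tau> j) / of_real (real N)" by simp
      with j z show False by (auto simp: P_def)
    qed
  qed
  have kern_le: "cmod (kern (w j z)) \<le> 3 / c\<^sup>2 * (1 / (x * (1 + x)))"
    if "j \<in> I" "z \<in> D \<union> path_image g" "0 < c" "c \<le> 1" "0 < x" "x = N * \<bar>t - \<tau> j\<bar>"
      "\<And>s. s \<in> {0..1} \<Longrightarrow> c * L * \<bar>s - t\<bar> \<le> cmod (z - g s)" for j z c x t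
  proof (rule norm_kern_le[OF shift[OF that(1,2)] _ that(5,3,4)])
    have "c * x = real N * (c * L * \<bar>\<tau> j - t\<bar>) / L" using L_pos that(6) by (simp add: abs_minus_commute)
    also have "\<dots> \<le> real N * cmod (z - g (\<tau> j)) / L"
      using that(7)[OF \<tau>01[OF that(1)]] L_pos by (intro divide_right_mono mult_left_mono) auto
    also note w_ge[OF that(1)]
    finally show "c * x \<le> cmod (w j z)" .
  qed
  have regular_good: "t \<in> G'" if "regular t v" "t \<notin> B" for t v
    using GB[OF that(1)] that by (auto simp: G'_def B_def)
  have offsets: "spaced_offsets I (nat \<lfloor>real N * t\<rfloor>) (\<lambda>j. N * \<bar>t - \<tau> j\<bar>) \<kappa>'"
    and own: "nat \<lfloor>real N * t\<rfloor> \<in> I" "N * \<bar>t - \<tau> (nat \<lfloor>real N * t\<rfloor>)\<bar> \<le> 1"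
    if reg: "regular t v" and tB: "t \<notin> B" for t v
  proof -
    note t = regularD[OF reg]
    define k where "k = nat \<lfloor>real N * t\<rfloor>"
    have "0 \<le> real N * t" using t by simp
    then have k: "real k \<le> real N * t" "real N * t < real k + 1" unfolding k_def by linarith+
    have "real N * t < real N" using t N by simp
    with k have "k < N" by linarith
    moreover have "real k / N \<le> t" "t \<le> (real k + 1) / N" using k N by (auto simp: field_simps)
    ultimately have "k \<in> I" using regular_good[OF reg tB] by (auto simp: I_def)
    then show "nat \<lfloor>real N * t\<rfloor> \<in> I" by (simp add: k_def)
    have Nabs: "N * \<bar>t - \<tau> j\<bar> = \<bar>real N * t - real N * \<tau> j\<bar>" for j
      by (simp add: abs_mult flip: right_diff_distrib)
    have "\<bar>real N * t - real N * \<tau> k\<bar> \<le> 1" using \<tau>N[OF \<open>k \<in> I\<close>] k by linarith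
    then show "N * \<bar>t - \<tau> (nat \<lfloor>real N * t\<rfloor>)\<bar> \<le> 1" unfolding Nabs k_def .
    show "spaced_offsets I (nat \<lfloor>real N * t\<rfloor>) (\<lambda>j. N * \<bar>t - \<tau> j\<bar>) \<kappa>'"
      unfolding k_def[symmetric]
    proof
      fix j assume j: "j \<in> I"
      show "\<bar>real j - real k\<bar> - 1 \<le> N * \<bar>t - \<tau> j\<bar>"
        unfolding Nabs using \<tau>N[OF j] k by linarith
      have "t \<notin> {\<tau> j - \<kappa>' / N .. \<tau> j + \<kappa>' / N}" using tB j by (auto simp: B_def)
      then have "\<kappa>' / N \<le> \<bar>t - \<tau> j\<bar>" by (auto simp: not_le)
      then show "\<kappa>' \<le> N * \<bar>t - \<tau> j\<bar>" using N by (simp add: field_simps)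
    qed (use fin kappa' in auto)
  qed
  have sum_mod: "(\<Sum>j\<in>I. (\<delta> + C * \<bar>t - \<tau> j\<bar>) * (1 / (N * \<bar>t - \<tau> j\<bar> * (1 + N * \<bar>t - \<tau> j\<bar>)))) \<le> \<eta>"
    if "regular t v" "t \<notin> B" for t v
  proof -
    interpret spaced_offsets I "nat \<lfloor>real N * t\<rfloor>" "\<lambda>j. N * \<bar>t - \<tau> j\<bar>" \<kappa>' by (rule offsets[OF that])
    have eq: "real N * \<bar>t - \<tau> j\<bar> / real N = \<bar>t - \<tau> j\<bar>" for j using N by simp
    show ?thesis
      using sum_modulus_le[OF cardI N less_imp_le[OF delta(1)] C] delta(2) N_eta
      unfolding eq Q_def[symmetric] by linarith
  qed
  have x_pos: "0 < N * \<bar>t - \<tau> j\<bar>" if "regular t v" "t \<notin> B" "j \<in> I" for t v j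
    using spaced_offsets.x_ge(2)[OF offsets[OF that(1,2)] that(3)] kappa' by linarith
  show thesis
  proof (rule that[of P f B])
    show "finite P" using fin by (auto simp: P_def)
    show "P \<inter> D = {}"
    proof -
      have "g (\<tau> j) \<notin> D" if "j \<in> I" for j using in_path_image[OF \<tau>01[OF that]] D_disjoint by blast
      moreover have "g (\<tau> j) - \<i> * U (\<tau> j) / complex_of_real (real N) \<notin> D" if j: "j \<in> I" for j
      proof
        assume "g (\<tau> j) - \<i> * U (\<tau> j) / complex_of_real (real N) \<in> D"
        then have "(1 + cmod (w j (g (\<tau> j) - \<i> * U (\<tau> j) / complex_of_real (real N)))) / 3
            \<le> cmod (w j (g (\<tau> j) - \<i> * U (\<tau> j) / complex_of_real (real N)) + \<i>)"
          by (intro shift j) auto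
        moreover have "w j (g (\<tau> j) - \<i> * U (\<tau> j) / complex_of_real (real N)) = - \<i>"
          using U(3)[OF \<tau>(1)[OF j]] N by (simp add: w_def)
        ultimately show False by simp
      qed
      ultimately show ?thesis by (auto simp: P_def)
    qed
    show "f holomorphic_on - P"
      unfolding f_def kern_def w_def using w_nz U(3)[OF \<tau>(1)]
      by (intro holomorphic_intros) (auto simp: w_def)
    show "f \<in> borel_measurable borel"
      unfolding f_def kern_def w_def by measurable
    have len: "measure lebesgue {\<tau> j - \<kappa>' / N .. \<tau> j + \<kappa>' / N} = 2 * \<kappa>' / N" for j
      using kappa' by simp
    have un: "(\<Union>j\<in>I. {\<tau> j - \<kappa>' / N .. \<tau> j + \<kappa>' / N}) \<in> lmeasurable"
      using fin by (intro fmeasurable.finite_UN) auto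
    then show "B \<in> lmeasurable" unfolding B_def using B0(1) by (intro fmeasurable.Un)
    have "measure lebesgue (\<Union>j\<in>I. {\<tau> j - \<kappa>' / N .. \<tau> j + \<kappa>' / N})
        \<le> (\<Sum>j\<in>I. measure lebesgue {\<tau> j - \<kappa>' / N .. \<tau> j + \<kappa>' / N})"
      using fin by (intro measure_UNION_le) auto
    also have "\<dots> = real (card I) * (2 * \<kappa>' / N)" unfolding len by simp
    also have "\<dots> \<le> real N * (2 * \<kappa>' / N)" using cardI kappa' by (intro mult_right_mono) auto
    also have "\<dots> = \<kappa> / 2" using N by (simp add: \<kappa>'_def)
    finally have "measure lebesgue (\<Union>j\<in>I. {\<tau> j - \<kappa>' / N .. \<tau> j + \<kappa>' / N}) \<le> \<kappa> / 2" .
    moreover have "measure lebesgue B \<le> measure lebesgue B0 + measure lebesgue (\<Union>j\<in>I. {\<tau> j - \<kappa>' / N .. \<tau> j + \<kappa>' / N})"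
      unfolding B_def using B0(1) un by (intro measure_Un_le) auto
    ultimately show "measure lebesgue B \<le> \<kappa>" using B0(2) by simp
  next
    fix z assume z: "z \<in> K"
    define x where "x = real N * d / L"
    have x: "2 \<le> x" using N_d L_pos by (simp add: x_def field_simps)
    \<comment> \<open>Here the quadratic decay pays off: at most \<open>N\<close> terms of order
      \<open>1 / N\<^sup>2\<close> add up to order \<open>1 / N\<close>, whereas simple poles would
      only give a bound independent of \<open>N\<close>.\<close>
    have "cmod (kern (w j z)) \<le> 3 / x\<^sup>2" if j: "j \<in> I" for j
    proof -
      have "x \<le> real N * cmod (z - g (\<tau> j)) / L"
        unfolding x_def using d(2)[OF z in_path_image[OF \<tau>01[OF j]]] L_pos
        by (intro divide_right_mono mult_left_mono) (auto simp: dist_norm)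
      also note w_ge[OF j]
      finally have "x \<le> cmod (w j z)" .
      then have "cmod (kern (w j z)) \<le> 3 / 1\<^sup>2 * (1 / (x * (1 + x)))"
        using shift[OF j, of z] z K(2) x by (intro norm_kern_le) auto
      also have "\<dots> \<le> 3 / 1\<^sup>2 * (1 / (x * x))"
        using x by (intro mult_left_mono divide_left_mono mult_pos_pos) auto
      finally show ?thesis by (simp add: power2_eq_square)
    qed
    then have "cmod (\<psi> (\<tau> j) * kern (w j z)) \<le> M * (3 / x\<^sup>2)" if "j \<in> I" for j
      unfolding norm_mult using M(1) M(2)[OF \<tau>G[OF that]] that by (intro mult_mono) auto
    then have "cmod (\<Sum>j\<in>I. \<psi> (\<tau> j) * kern (w j z)) \<le> (\<Sum>j\<in>I. M * (3 / x\<^sup>2))"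
      by (rule sum_norm_le)
    also have "\<dots> = real (card I) * (M * (3 / x\<^sup>2))" by simp
    also have "\<dots> \<le> real N * (M * (3 / x\<^sup>2))" using cardI M by (intro mult_right_mono) auto
    also have "\<dots> = 3 * M * L\<^sup>2 / (d\<^sup>2 * real N)"
      using N d L_pos by (simp add: x_def power2_eq_square field_simps)
    also note N_K
    finally have "cmod (\<Sum>j\<in>I. \<psi> (\<tau> j) * kern (w j z)) \<le> \<kappa>" .
    then show "cmod (f z) \<le> \<kappa>" unfolding f_def norm_mult using kappa by simp
  next
    fix t v assume reg: "regular t v" and tB: "t \<notin> B"
    note t = regularD[OF reg]
    have t01: "t \<in> {0..1}" using t by simp
    have tG': "t \<in> G'" by (rule regular_good[OF reg tB])
    then have tG: "t \<in> G" by (rule G'G)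
    \<comment> \<open>Position of \<open>g t\<close> relative to sample \<open>j\<close> after
      straightening. The sign records whether \<open>U\<close> reverses the tangent vector; the
      Poisson kernel is even, so only \<open>abs_y\<close> matters for the real part.\<close>
    define y where "y j = (if U (\<tau> j) = V (\<tau> j) then N * (t - \<tau> j) else - (N * (t - \<tau> j)))" for j
    have abs_y: "\<bar>y j\<bar> = N * \<bar>t - \<tau> j\<bar>" for j by (simp add: y_def abs_mult)
    define F where "F j = (\<delta> + C * \<bar>t - \<tau> j\<bar>) * (1 / (N * \<bar>t - \<tau> j\<bar> * (1 + N * \<bar>t - \<tau> j\<bar>)))" for j
    have sep_t: "cc * L * \<bar>s - t\<bar> \<le> cmod (g t - g s)" if "s \<in> {0..1}" for s
      using sep[OF tG that] mult_right_mono[OF cc(3), of "\<bar>s - t\<bar>"] by (simp add: norm_minus_commute)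
    have dipole: "cmod (\<psi> (\<tau> j) * kern (w j (g t)) - \<psi> t * kern (of_real (y j))) \<le> W * F j" if j: "j \<in> I" for j
    proof -
      define X where "X = N * \<bar>t - \<tau> j\<bar>"
      define e where "e = (\<delta> + C * \<bar>t - \<tau> j\<bar>) / c0"
      have X: "0 < X" unfolding X_def by (rule x_pos[OF reg tB j])
      have gt: "g t \<in> D \<union> path_image g" using in_path_image[OF t01] by simp
      have k1: "cmod (kern (w j (g t))) \<le> 3 / cc\<^sup>2 * (1 / (X * (1 + X)))"
        by (rule kern_le[OF j gt cc(1,2) X X_def sep_t])
      have near: "cmod (w j (g t) - of_real (y j)) \<le> e * \<bar>y j\<bar>"
      proof -
        let ?V = "V (\<tau> j)"
        have V0: "?V \<noteq> 0" using regularD(3)[OF reg_V[OF \<tau>(1)[OF j]]] .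
        have eq: "w j (g t) - of_real (y j) = (if U (\<tau> j) = ?V then 1 else - 1) *
            (of_real (real N) * (g t - g (\<tau> j) - of_real (t - \<tau> j) * ?V) / ?V)"
          using UV[OF \<tau>(1)[OF j]] V0 N
          by (auto simp: w_def y_def diff_divide_distrib right_diff_distrib)
        have "cmod (w j (g t) - of_real (y j)) = real N * cmod (g t - g (\<tau> j) - of_real (t - \<tau> j) * ?V) / cmod ?V"
          unfolding eq by (simp add: norm_mult norm_divide)
        also have "\<dots> \<le> real N * ((\<delta> + C * \<bar>t - \<tau> j\<bar>) * \<bar>t - \<tau> j\<bar>) / c0"
          using g_mod[OF \<tau>G[OF j] reg_V[OF \<tau>(1)[OF j]] t01] speed(1)[OF reg_V[OF \<tau>(1)[OF j]] \<tau>G[OF j]] c0 delta C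
          by (intro frac_le mult_left_mono mult_nonneg_nonneg) auto
        also have "\<dots> = e * \<bar>y j\<bar>" by (simp add: e_def abs_y)
        finally show ?thesis .
      qed
      have c_le: "cc * \<bar>y j\<bar> \<le> cmod (w j (g t))"
      proof -
        have "cc * \<bar>y j\<bar> = real N * (cc * L * \<bar>\<tau> j - t\<bar>) / L" using L_pos by (simp add: abs_y abs_minus_commute)
        also have "\<dots> \<le> real N * cmod (g t - g (\<tau> j)) / L"
          using sep_t[OF \<tau>01[OF j]] L_pos by (intro divide_right_mono mult_left_mono) auto
        also note w_ge[OF j]
        finally show ?thesis .
      qed
      have y0: "y j \<noteq> 0" using X abs_y[of j] by (auto simp: X_def)
      have k2: "cmod (kern (w j (g t)) - kern (of_real (y j))) \<le> 12 * e / cc\<^sup>2 * (1 / (X * (1 + X)))"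
        using norm_kern_diff_le[OF shift[OF j gt] near c_le cc(1,2) y0] by (simp only: abs_y X_def)
      have "a * (3 / q * Z) + M * (12 * (a / c0) / q * Z) = (3 / q + 12 * M / (c0 * q)) * (a * Z)" for a q Z :: real
        by (simp add: algebra_simps)
      from this[of "\<delta> + C * \<bar>t - \<tau> j\<bar>" "cc\<^sup>2" "1 / (X * (1 + X))"]
      have WF: "(\<delta> + C * \<bar>t - \<tau> j\<bar>) * (3 / cc\<^sup>2 * (1 / (X * (1 + X)))) + M * (12 * e / cc\<^sup>2 * (1 / (X * (1 + X)))) = W * F j"
        by (simp only: W_def F_def e_def X_def)
      have "\<psi> (\<tau> j) * kern (w j (g t)) - \<psi> t * kern (of_real (y j)) =
          (\<psi> (\<tau> j) - \<psi> t) * kern (w j (g t)) + \<psi> t * (kern (w j (g t)) - kern (of_real (y j)))"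
        by (simp add: algebra_simps)
      then have "cmod (\<psi> (\<tau> j) * kern (w j (g t)) - \<psi> t * kern (of_real (y j))) \<le>
          cmod (\<psi> (\<tau> j) - \<psi> t) * cmod (kern (w j (g t))) + cmod (\<psi> t) * cmod (kern (w j (g t)) - kern (of_real (y j)))"
        by (metis norm_triangle_ineq norm_mult)
      also have "\<dots> \<le> (\<delta> + C * \<bar>t - \<tau> j\<bar>) * (3 / cc\<^sup>2 * (1 / (X * (1 + X)))) + M * (12 * e / cc\<^sup>2 * (1 / (X * (1 + X))))"
        using psi_mod[OF \<tau>G[OF j] tG] k1 k2 M(2)[OF tG] M(1) delta C
        by (intro add_mono mult_mono[OF _ k1] mult_mono[OF _ k2]) (auto simp: abs_minus_commute)
      also note WF
      finally show ?thesis .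
    qed
    define S where "S = (\<Sum>j\<in>I. kern (complex_of_real (y j)))"
    have "cmod (20 * f (g t) - \<psi> t * S) = cmod (\<Sum>j\<in>I. \<psi> (\<tau> j) * kern (w j (g t)) - \<psi> t * kern (of_real (y j)))"
      by (simp add: f_def S_def sum_distrib_left sum_subtractf)
    also have "\<dots> \<le> (\<Sum>j\<in>I. W * F j)" by (intro sum_norm_le dipole)
    also have "\<dots> = W * (\<Sum>j\<in>I. F j)" by (simp add: sum_distrib_left)
    also have "\<dots> \<le> W * \<eta>" using sum_mod[OF reg tB] W by (intro mult_left_mono) (auto simp: F_def)
    also have "\<dots> = \<kappa>\<^sup>2" by (rule eta)
    finally have err: "cmod (20 * f (g t) - \<psi> t * S) \<le> \<kappa>\<^sup>2" .
    have Re_S: "Re S = (\<Sum>j\<in>I. 1 / (1 + (N * \<bar>t - \<tau> j\<bar>)\<^sup>2))"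
    proof -
      have "Re (kern (complex_of_real (y j))) = 1 / (1 + (N * \<bar>t - \<tau> j\<bar>)\<^sup>2)" if "j \<in> I" for j
      proof -
        have "y j \<noteq> 0" using x_pos[OF reg tB that] abs_y[of j] by auto
        from Re_kern_of_real[OF this] show ?thesis unfolding abs_y[symmetric] by simp
      qed
      then show ?thesis unfolding S_def Re_sum by (intro sum.cong) auto
    qed
    have S20: "Re S \<le> 20" unfolding Re_S by (rule spaced_offsets.sum_poisson_le[OF offsets[OF reg tB]])
    \<comment> \<open>The sample in the cell of \<open>t\<close> is at scaled distance at most 1 and
      alone contributes 1/2. Hence \<open>20 - Re S\<close> lies between 0 and 39/2, and division by
      20 gives the contraction.\<close>
    have S1: "1 / 2 \<le> Re S"
    proof -
      let ?k = "nat \<lfloor>real N * t\<rfloor>"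
      have "(N * \<bar>t - \<tau> ?k\<bar>)\<^sup>2 \<le> 1" using own(2)[OF reg tB] by (simp add: power_le_one)
      then have "1 / 2 \<le> 1 / (1 + (N * \<bar>t - \<tau> ?k\<bar>)\<^sup>2)"
        by (intro divide_left_mono mult_pos_pos add_pos_nonneg) auto
      also have "\<dots> \<le> Re S"
        unfolding Re_S using own(1)[OF reg tB] fin by (intro member_le_sum) (auto simp: add_nonneg_nonneg)
      finally show ?thesis .
    qed
    have "Re (cnj (\<nu> t) * (\<psi> t * S)) = r t * Re S"
    proof -
      have "cnj (\<nu> t) * \<nu> t = 1" using unit[OF t01] by (metis complex_norm_square mult.commute of_real_1 one_power2)
      moreover have "cnj (\<nu> t) * (\<psi> t * S) = (cnj (\<nu> t) * \<nu> t) * (of_real (r t) * S)"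
        by (simp add: \<psi>_def mult_ac)
      ultimately have "cnj (\<nu> t) * (\<psi> t * S) = of_real (r t) * S" by (simp only: mult_1)
      then have "Re (cnj (\<nu> t) * (\<psi> t * S)) = Re (of_real (r t) * S)" by (rule arg_cong)
      also have "\<dots> = r t * Re S" by simp
      finally show ?thesis .
    qed
    moreover have "\<bar>Re (cnj (\<nu> t) * (20 * f (g t) - \<psi> t * S))\<bar> \<le> \<kappa>\<^sup>2"
    proof -
      have "\<bar>Re (cnj (\<nu> t) * (20 * f (g t) - \<psi> t * S))\<bar> \<le> cmod (cnj (\<nu> t) * (20 * f (g t) - \<psi> t * S))"
        by (rule abs_Re_le_cmod)
      also have "\<dots> = cmod (20 * f (g t) - \<psi> t * S)" using unit[OF t01] by (simp add: norm_mult)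
      finally show ?thesis using err by simp
    qed
    moreover have "Re (cnj (\<nu> t) * (20 * f (g t) - \<psi> t * S)) = 20 * Re (cnj (\<nu> t) * f (g t)) - Re (cnj (\<nu> t) * (\<psi> t * S))"
      by (simp add: algebra_simps)
    ultimately have e1: "\<bar>20 * Re (cnj (\<nu> t) * f (g t)) - r t * Re S\<bar> \<le> \<kappa>\<^sup>2" by simp
    have "\<bar>20 * r t - r t * Re S\<bar> = \<bar>r t\<bar> * (20 - Re S)"
    proof -
      have "20 * r t - r t * Re S = r t * (20 - Re S)" by (simp add: algebra_simps)
      then show ?thesis using S20 by (simp add: abs_mult)
    qed
    also have "\<dots> \<le> \<bar>r t\<bar> * (39 / 2)" using S1 by (intro mult_left_mono) auto
    finally show "\<bar>r t - Re (cnj (\<nu> t) * f (g t))\<bar> \<le> 39/40 * \<bar>r t\<bar> + \<kappa>\<^sup>2"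
      using e1 zero_le_power2[of \<kappa>] by linarith
  next
    fix t v z c assume reg: "regular t v" and tB: "t \<notin> B" and z: "z \<in> D" and c: "0 < c" "c \<le> 1"
      and sepz: "\<And>s. s \<in> {0..1} \<Longrightarrow> c * L * \<bar>s - t\<bar> \<le> cmod (z - g s)"
    have t01: "t \<in> {0..1}" using regularD[OF reg] by simp
    have tG: "t \<in> G" using regular_good[OF reg tB] by (rule G'G)
    define Y where "Y j = 1 / (N * \<bar>t - \<tau> j\<bar> * (1 + N * \<bar>t - \<tau> j\<bar>))" for j
    have "cmod (\<psi> (\<tau> j) * kern (w j z)) \<le> 3 / c\<^sup>2 * (\<bar>r t\<bar> * Y j + (\<delta> + C * \<bar>t - \<tau> j\<bar>) * Y j)" if j: "j \<in> I" for j
    proof -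
      have "cmod (\<psi> (\<tau> j)) \<le> cmod (\<psi> t) + cmod (\<psi> (\<tau> j) - \<psi> t)" by (rule norm_triangle_sub)
      then have "cmod (\<psi> (\<tau> j)) \<le> \<bar>r t\<bar> + (\<delta> + C * \<bar>t - \<tau> j\<bar>)"
        using psi_mod[OF \<tau>G[OF j] tG] norm_psi[OF t01] by (simp add: abs_minus_commute)
      moreover have "cmod (kern (w j z)) \<le> 3 / c\<^sup>2 * Y j"
        unfolding Y_def using z by (intro kern_le[OF j _ c x_pos[OF reg tB j] refl sepz]) auto
      ultimately have "cmod (\<psi> (\<tau> j)) * cmod (kern (w j z)) \<le> (\<bar>r t\<bar> + (\<delta> + C * \<bar>t - \<tau> j\<bar>)) * (3 / c\<^sup>2 * Y j)"
        using delta C by (intro mult_mono) auto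
      then show ?thesis by (simp add: norm_mult algebra_simps add_divide_distrib)
    qed
    then have "cmod (\<Sum>j\<in>I. \<psi> (\<tau> j) * kern (w j z)) \<le> (\<Sum>j\<in>I. 3 / c\<^sup>2 * (\<bar>r t\<bar> * Y j + (\<delta> + C * \<bar>t - \<tau> j\<bar>) * Y j))"
      by (rule sum_norm_le)
    also have "\<dots> = 3 / c\<^sup>2 * (\<bar>r t\<bar> * (\<Sum>j\<in>I. Y j) + (\<Sum>j\<in>I. (\<delta> + C * \<bar>t - \<tau> j\<bar>) * Y j))"
      by (simp only: sum_distrib_left[symmetric] sum.distrib)
    also have "\<dots> \<le> 3 / c\<^sup>2 * (\<bar>r t\<bar> * Q + \<eta>)"
      unfolding Q_def Y_def using spaced_offsets.sum_weight_le[OF offsets[OF reg tB]] sum_mod[OF reg tB]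
      by (intro mult_left_mono add_mono) auto
    also have "\<dots> \<le> 3 / c\<^sup>2 * (\<bar>r t\<bar> * (72 / \<kappa>) + \<kappa>)"
      using eta Q(2) by (intro mult_left_mono add_mono) auto
    finally have sum_le: "cmod (\<Sum>j\<in>I. \<psi> (\<tau> j) * kern (w j z)) \<le> 3 / c\<^sup>2 * (\<bar>r t\<bar> * (72 / \<kappa>) + \<kappa>)" .
    have "cmod (f z) = 1 / 20 * cmod (\<Sum>j\<in>I. \<psi> (\<tau> j) * kern (w j z))"
      unfolding f_def norm_mult by simp
    also have "\<dots> \<le> 1 / 20 * (3 / c\<^sup>2 * (\<bar>r t\<bar> * (72 / \<kappa>) + \<kappa>))"
      by (intro mult_left_mono sum_le) simp
    \<comment> \<open>The fraction is 3 * 72 / 20, rounded up to 12 in the next step.\<close>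
    also have "\<dots> = (54 / 5 * \<bar>r t\<bar> / \<kappa> + 3 / 20 * \<kappa>) / c\<^sup>2"
      by (simp add: add_divide_distrib algebra_simps)
    also have "\<dots> \<le> (12 * \<bar>r t\<bar> / \<kappa> + \<kappa>) / c\<^sup>2"
      using kappa by (intro divide_right_mono add_mono) auto
    finally show "cmod (f z) \<le> (12 * \<bar>r t\<bar> / \<kappa> + \<kappa>) / c\<^sup>2" .
  qed
qed

section \<open>Iteration\<close>

text \<open>Along a path three errors occur: the tail of the series, uniformly small in the
  nontangential region; the variation of a partial sum, which is continuous at \<open>g t\<close>
  unless \<open>g t\<close> is a pole; and the residual at \<open>t\<close>, which tends to zero.
  Smallness on \<open>K\<close> comes from the sum of all tolerances.\<close>

lemma boundary_problem_small_solution: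
  fixes r :: "real \<Rightarrow> real" and \<nu> :: "real \<Rightarrow> complex"
  assumes unit: "\<And>t. t \<in> {0..1} \<Longrightarrow> cmod (\<nu> t) = 1"
    and meas: "r \<in> borel_measurable (lebesgue_on {0..1})" "\<nu> \<in> borel_measurable (lebesgue_on {0..1})"
    and K: "compact K" "K \<subseteq> D" and e: "0 < \<epsilon>"
  obtains F :: "complex \<Rightarrow> complex" where "F holomorphic_on D" "\<And>z. z \<in> K \<Longrightarrow> cmod (F z) \<le> \<epsilon>"
    "AE t in lebesgue_on {0..1}. \<forall>v. regular t v \<longrightarrow> (\<forall>p. nontangential_path D (g t) v p \<longrightarrow>
       ((\<lambda>s. Re (cnj (\<nu> t) * F (p s))) \<longlongrightarrow> r t) (at_left 1))"
proof -
  \<comment> \<open>The requirement is \<open>q < 1\<close> with \<open>q\<^sup>2\<close> above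
    39/40; here the square is 0.9801.\<close>
  define q :: real where "q = 99 / 100"
  have q: "0 < q" "q < 1" "39 / 40 < q\<^sup>2" by (auto simp: q_def power2_eq_square)
  \<comment> \<open>Keeps the total \<open>k0 / (1 - q)\<close> of the tolerances at most
    \<open>\<epsilon>\<close>.\<close>
  define k0 where "k0 = min 1 (\<epsilon> * (1 - q))"
  have k0: "0 < k0" "k0 \<le> 1" "k0 \<le> \<epsilon> * (1 - q)" using e q by (auto simp: k0_def)
  define \<kappa> where "\<kappa> n = k0 * q ^ n" for n
  have kappa: "0 < \<kappa> n" "\<kappa> n \<le> 1" for n
    using k0 q by (auto simp: \<kappa>_def intro!: mult_le_one power_le_one)
  have kappa_sums: "\<kappa> sums (k0 / (1 - q))"
    unfolding \<kappa>_def using sums_mult[OF geometric_sums[of q], of k0] q by simp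
  have kappa_sum: "suminf \<kappa> \<le> \<epsilon>" and kappa_summable: "summable \<kappa>"
  proof -
    show "summable \<kappa>" using kappa_sums by (rule sums_summable)
    have "suminf \<kappa> = k0 / (1 - q)" using kappa_sums by (rule sums_unique[symmetric])
    also have "\<dots> \<le> \<epsilon>" using k0 q by (simp add: pos_divide_le_eq)
    finally show "suminf \<kappa> \<le> \<epsilon>" .
  qed
  obtain X where X: "\<And>n. compact (X n)" "\<And>n. X n \<subseteq> D" "\<And>n. X n \<subseteq> interior (X (Suc n))" "\<Union> (range X) = D"
    "\<And>Y. \<lbrakk>compact Y; Y \<subseteq> D\<rbrakk> \<Longrightarrow> \<exists>N. \<forall>n\<ge>N. Y \<subseteq> (X n :: complex set)"
    by (rule open_Union_compact_subsets[OF open_D]) (rule that)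
  define good where "good n \<rho> f P B \<longleftrightarrow> finite P \<and> P \<inter> D = {} \<and> f holomorphic_on - P \<and> f \<in> borel_measurable borel \<and>
    B \<in> lmeasurable \<and> measure lebesgue B \<le> \<kappa> n \<and> (\<forall>z\<in>K \<union> X n. cmod (f z) \<le> \<kappa> n) \<and>
    (\<forall>t v. regular t v \<longrightarrow> t \<notin> B \<longrightarrow> \<bar>\<rho> t - Re (cnj (\<nu> t) * f (g t))\<bar> \<le> 39/40 * \<bar>\<rho> t\<bar> + (\<kappa> n)\<^sup>2) \<and>
    (\<forall>t v z c. regular t v \<longrightarrow> t \<notin> B \<longrightarrow> z \<in> D \<longrightarrow> 0 < c \<longrightarrow> c \<le> 1 \<longrightarrow>
        (\<forall>s\<in>{0..1}. c * L * \<bar>s - t\<bar> \<le> cmod (z - g s)) \<longrightarrow> cmod (f z) \<le> (12 * \<bar>\<rho> t\<bar> / \<kappa> n + \<kappa> n) / c\<^sup>2)"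
    for n and \<rho> :: "real \<Rightarrow> real" and f :: "complex \<Rightarrow> complex" and P :: "complex set" and B :: "real set"
  have ex: "\<exists>T. good n \<rho> (fst T) (fst (snd T)) (snd (snd T))" if \<rho>: "\<rho> \<in> borel_measurable (lebesgue_on {0..1})" for n \<rho>
  proof -
    have KX: "compact (K \<union> X n)" "K \<union> X n \<subseteq> D" using K X by auto
    show ?thesis
    proof (rule correction_step[OF unit \<rho> meas(2) kappa(1,2)[of n] KX])
      fix f P B
      assume "finite P" "P \<inter> D = {}" "f holomorphic_on - P" "f \<in> borel_measurable borel"
        "B \<in> lmeasurable" "measure lebesgue B \<le> \<kappa> n" "\<And>z. z \<in> K \<union> X n \<Longrightarrow> cmod (f z) \<le> \<kappa> n"
        "\<And>t v. regular t v \<Longrightarrow> t \<notin> B \<Longrightarrow> \<bar>\<rho> t - Re (cnj (\<nu> t) * f (g t))\<bar> \<le> 39/40 * \<bar>\<rho> t\<bar> + (\<kappa> n)\<^sup>2"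
        "\<And>t v z c. \<lbrakk>regular t v; t \<notin> B; z \<in> D; 0 < c; c \<le> 1;
          \<And>s. s \<in> {0..1} \<Longrightarrow> c * L * \<bar>s - t\<bar> \<le> cmod (z - g s)\<rbrakk> \<Longrightarrow> cmod (f z) \<le> (12 * \<bar>\<rho> t\<bar> / \<kappa> n + \<kappa> n) / c\<^sup>2"
      then have "good n \<rho> f P B" unfolding good_def by blast
      then show ?thesis by (intro exI[of _ "(f, P, B)"]) simp
    qed
  qed
  \<comment> \<open>The next residual depends on the correction chosen, so the choice is made as a
    function of index and residual. Its specification is known for measurable residuals, and
    \<open>R_meas\<close> shows inductively that all residuals are measurable.\<close>
  define T where "T n \<rho> = (SOME T. good n \<rho> (fst T) (fst (snd T)) (snd (snd T)))" for n \<rho>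
  define Fc where "Fc n \<rho> = fst (T n \<rho>)" for n \<rho>
  have choice: "good n \<rho> (Fc n \<rho>) (fst (snd (T n \<rho>))) (snd (snd (T n \<rho>)))"
    if "\<rho> \<in> borel_measurable (lebesgue_on {0..1})" for n \<rho>
    unfolding Fc_def T_def by (rule someI_ex[OF ex[OF that]])
  define R where "R = rec_nat r (\<lambda>n \<rho> t. \<rho> t - Re (cnj (\<nu> t) * Fc n \<rho> (g t)))"
  have R0: "R 0 = r" and R_Suc: "R (Suc n) = (\<lambda>t. R n t - Re (cnj (\<nu> t) * Fc n (R n) (g t)))" for n
    by (simp_all add: R_def)
  have g_meas: "g \<in> borel_measurable (lebesgue_on {0..1})"
    by (intro continuous_imp_measurable_on_sets_lebesgue continuous_g) auto
  have R_meas: "R n \<in> borel_measurable (lebesgue_on {0..1})" for n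
  proof (induction n)
    case 0 then show ?case using meas by (simp add: R0)
  next
    case (Suc n)
    have "Fc n (R n) \<in> borel_measurable borel" using choice[OF Suc] by (auto simp: good_def)
    then have Fg: "(\<lambda>t. Fc n (R n) (g t)) \<in> borel_measurable (lebesgue_on {0..1})"
      by (rule measurable_compose[OF g_meas])
    have cnj_meas: "(\<lambda>t. cnj (\<nu> t)) \<in> borel_measurable (lebesgue_on {0..1})"
      by (rule measurable_compose[OF meas(2)]) (intro borel_measurable_continuous_onI continuous_intros)
    have "(\<lambda>t. Re (cnj (\<nu> t) * Fc n (R n) (g t))) \<in> borel_measurable (lebesgue_on {0..1})"
      by (rule measurable_compose[OF borel_measurable_times[OF cnj_meas Fg]])
        (intro borel_measurable_continuous_onI continuous_intros)
    with Suc show ?case unfolding R_Suc by (rule borel_measurable_diff)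
  qed
  define f where "f n = Fc n (R n)" for n
  define P where "P n = fst (snd (T n (R n)))" for n
  define B where "B n = snd (snd (T n (R n)))" for n
  have gd: "good n (R n) (f n) (P n) (B n)" for n
    unfolding f_def P_def B_def by (rule choice[OF R_meas])
  have P: "finite (P n)" "P n \<inter> D = {}" and f_hol: "f n holomorphic_on - P n"
    and B: "B n \<in> lmeasurable" "measure lebesgue (B n) \<le> \<kappa> n"
    and f_small: "\<And>z. z \<in> K \<union> X n \<Longrightarrow> cmod (f n z) \<le> \<kappa> n" for n
    using gd[of n] by (auto simp: good_def)
  have R_step: "\<bar>R (Suc n) t\<bar> \<le> 39/40 * \<bar>R n t\<bar> + (\<kappa> n)\<^sup>2" if "regular t v" "t \<notin> B n" for n t v
    using gd[of n] that unfolding R_Suc f_def[symmetric] by (auto simp: good_def)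
  have f_cone: "cmod (f n z) \<le> (12 * \<bar>R n t\<bar> / \<kappa> n + \<kappa> n) / c\<^sup>2"
    if "regular t v" "t \<notin> B n" "z \<in> D" "0 < c" "c \<le> 1" "\<forall>s\<in>{0..1}. c * L * \<bar>s - t\<bar> \<le> cmod (z - g s)" for n t v z c
    using gd[of n] that unfolding good_def by blast
  have f_hol_D: "f n holomorphic_on D" for n
    by (rule holomorphic_on_subset[OF f_hol]) (use P(2)[of n] in blast)
  define F where "F z = (\<Sum>n. f n z)" for z
  \<comment> \<open>Correction \<open>n\<close> is at most \<open>\<kappa> n\<close> on
    \<open>X n\<close>, and these sets eventually contain any given compact subset of
    \<open>D\<close>.\<close>
  have unif: "uniform_limit Y (\<lambda>n z. \<Sum>m<n. f m z) F sequentially" if Y: "compact Y" "Y \<subseteq> D" for Y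
    unfolding F_def
  proof (rule Weierstrass_m_test_ev[OF _ kappa_summable])
    obtain N where "\<And>n. n \<ge> N \<Longrightarrow> Y \<subseteq> X n" using X(5)[OF Y] by blast
    then show "\<forall>\<^sub>F n in sequentially. \<forall>z\<in>Y. cmod (f n z) \<le> \<kappa> n"
      using f_small unfolding eventually_sequentially by blast
  qed
  have F_sums: "(\<lambda>n. f n z) sums F z" if "z \<in> D" for z
    unfolding sums_def by (rule tendsto_uniform_limitI[OF unif[of "{z}"]]) (use that in auto)
  have F_hol: "F holomorphic_on D"
  proof (rule holomorphic_uniform_sequence[OF open_D])
    show "(\<lambda>z. \<Sum>m<n. f m z) holomorphic_on D" for n by (intro holomorphic_intros f_hol_D)
    fix z assume "z \<in> D"
    then obtain d where "0 < d" "cball z d \<subseteq> D" using open_D by (auto simp: open_contains_cball)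
    then show "\<exists>d>0. cball z d \<subseteq> D \<and> uniform_limit (cball z d) (\<lambda>n z. \<Sum>m<n. f m z) F sequentially"
      using unif[of "cball z d"] by auto
  qed
  have F_K: "cmod (F z) \<le> \<epsilon>" if "z \<in> K" for z
  proof -
    have "cmod (F z) \<le> suminf \<kappa>"
      unfolding F_def using f_small that kappa_summable by (intro norm_suminf_le) auto
    then show ?thesis using kappa_sum by simp
  qed
  have conv: "((\<lambda>s. Re (cnj (\<nu> t) * F (p s))) \<longlongrightarrow> r t) (at_left 1)"
    if reg: "regular t v" and path: "nontangential_path D (g t) v p"
      and tB: "\<forall>\<^sub>F n in sequentially. t \<notin> B n" and tP: "\<And>n. g t \<notin> P n" for t v p
  proof -
    have t01: "t \<in> {0..1}" using regularD[OF reg] by simp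
    obtain n0 where n0: "\<And>n. n0 \<le> n \<Longrightarrow> t \<notin> B n" using tB by (auto simp: eventually_sequentially)
    obtain A where A: "0 \<le> A" "\<And>n. n0 \<le> n \<Longrightarrow> \<bar>R n t\<bar> \<le> A * (q\<^sup>2) ^ n"
    proof (rule geometric_decay[of n0 "\<lambda>n. \<bar>R n t\<bar>" "39/40" "q\<^sup>2"])
      fix n assume "n0 \<le> n"
      then have "\<bar>R (Suc n) t\<bar> \<le> 39/40 * \<bar>R n t\<bar> + (\<kappa> n)\<^sup>2" by (intro R_step[OF reg] n0)
      moreover have "(\<kappa> n)\<^sup>2 \<le> (q ^ n)\<^sup>2"
        using k0 q unfolding \<kappa>_def by (intro power_mono mult_left_le_one_le) auto
      ultimately show "\<bar>R (Suc n) t\<bar> \<le> 39/40 * \<bar>R n t\<bar> + (q\<^sup>2) ^ n" by (simp add: power_mult[symmetric] mult.commute)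
    qed (use q in auto)
    obtain a b where ab: "(0 < a \<and> a \<le> b \<and> b < pi) \<or> (pi < a \<and> a \<le> b \<and> b < 2 * pi)"
      and in_sector: "\<forall>\<^sub>F s in at_left 1. p s \<in> sector (g t) v a b"
      and p_D: "p ` {0..<1} \<subseteq> D" and p_lim: "(p \<longlongrightarrow> g t) (at_left 1)"
      using path unfolding nontangential_path_def by blast
    obtain \<mu> where \<mu>: "0 < \<mu>"
      "\<And>z. z \<in> sector (g t) v a b \<Longrightarrow> \<mu> * cmod ((z - g t) / v) \<le> \<bar>Im ((z - g t) / v)\<bar>"
      using sector_nontangential[OF ab regularD(3)[OF reg]] by metis
    obtain c1 r1 where c1: "0 < c1" "0 < r1"
      "\<And>z s. \<lbrakk>cmod (z - g t) < r1; \<mu> * cmod ((z - g t) / v) \<le> \<bar>Im ((z - g t) / v)\<bar>; s \<in> {0..1}\<rbrakk>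
        \<Longrightarrow> c1 * \<bar>s - t\<bar> \<le> cmod (z - g s)"
      using nontangential_separation[OF reg \<mu>(1)] by metis
    define c where "c = min 1 (c1 / L)"
    have c: "0 < c" "c \<le> 1" "c * L \<le> c1"
    proof -
      show "0 < c" "c \<le> 1" using c1 L_pos by (auto simp: c_def)
      have "c * L \<le> c1 / L * L" using L_pos by (intro mult_right_mono) (auto simp: c_def)
      then show "c * L \<le> c1" using L_pos by simp
    qed
    define H where "H = (12 * A / k0 + 1) / c\<^sup>2"
    have tail: "cmod (F z - (\<Sum>m<n. f m z)) \<le> H * q ^ n / (1 - q)"
      if n: "n0 \<le> n" and z: "z \<in> D" "z \<in> sector (g t) v a b" "cmod (z - g t) < r1" for n z
    proof -
      have "\<forall>s\<in>{0..1}. c * L * \<bar>s - t\<bar> \<le> cmod (z - g s)"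
      proof
        fix s :: real assume "s \<in> {0..1}"
        then have "c1 * \<bar>s - t\<bar> \<le> cmod (z - g s)" using c1(3)[OF z(3) \<mu>(2)[OF z(2)]] by simp
        moreover have "c * L * \<bar>s - t\<bar> \<le> c1 * \<bar>s - t\<bar>" using c(3) by (rule mult_right_mono) simp
        ultimately show "c * L * \<bar>s - t\<bar> \<le> cmod (z - g s)" by linarith
      qed
      have fm: "cmod (f m z) \<le> H * q ^ m" if m: "n0 \<le> m" for m
      proof -
        have "cmod (f m z) \<le> (12 * \<bar>R m t\<bar> / \<kappa> m + \<kappa> m) / c\<^sup>2"
          by (rule f_cone[OF reg n0[OF m] z(1) c(1,2)]) fact
        also have "\<dots> \<le> (12 * (A * (q\<^sup>2) ^ m) / \<kappa> m + q ^ m) / c\<^sup>2"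
          using A(2)[OF m] kappa(1)[of m] k0 q
          by (intro divide_right_mono add_mono mult_left_mono) (auto simp: \<kappa>_def mult_left_le_one_le)
        \<comment> \<open>One of the two factors \<open>q ^ m\<close> in the residual pays for the
          division by \<open>\<kappa> m\<close>.\<close>
        also have "12 * (A * (q\<^sup>2) ^ m) / \<kappa> m = 12 * A / k0 * q ^ m"
          using k0 q by (simp add: \<kappa>_def power2_eq_square power_mult_distrib)
        also have "(12 * A / k0 * q ^ m + q ^ m) / c\<^sup>2 = H * q ^ m"
          by (simp add: H_def algebra_simps add_divide_distrib)
        finally show ?thesis .
      qed
      have "(\<lambda>m. f (m + n) z) sums (F z - (\<Sum>m<n. f m z))"
        using sums_split_initial_segment[OF F_sums[OF z(1)]] by simp
      then have "F z - (\<Sum>m<n. f m z) = (\<Sum>m. f (m + n) z)" by (rule sums_unique)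
      also have "cmod \<dots> \<le> (\<Sum>m. H * q ^ n * q ^ m)"
      proof (rule norm_suminf_le)
        show "cmod (f (m + n) z) \<le> H * q ^ n * q ^ m" for m
          using fm[of "m + n"] n by (simp add: power_add mult_ac)
        show "summable (\<lambda>m. H * q ^ n * q ^ m)" using q by (intro summable_mult summable_geometric) auto
      qed
      also have "\<dots> = H * q ^ n / (1 - q)" using q by (subst suminf_mult) (auto simp: suminf_geometric summable_geometric)
      finally show ?thesis .
    qed
    have R_sum: "R n t = r t - Re (cnj (\<nu> t) * (\<Sum>m<n. f m (g t)))" for n
      by (induction n) (simp_all add: R0 R_Suc f_def algebra_simps)
    show ?thesis
    proof (rule tendstoI)
      fix e' :: real assume e': "0 < e'"
      have "(\<lambda>n. A * (q\<^sup>2) ^ n) \<longlonglongrightarrow> A * 0" "(\<lambda>n. H * q ^ n / (1 - q)) \<longlonglongrightarrow> H * 0 / (1 - q)"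
        using q by (intro tendsto_intros LIMSEQ_realpow_zero; simp add: power_less_one_iff)+
      then have lims: "(\<lambda>n. A * (q\<^sup>2) ^ n) \<longlonglongrightarrow> 0" "(\<lambda>n. H * q ^ n / (1 - q)) \<longlonglongrightarrow> 0" by simp_all
      have "0 < e' / 3" using e' by simp
      from order_tendstoD(2)[OF lims(1) this] order_tendstoD(2)[OF lims(2) this] eventually_ge_at_top[of n0]
      have "\<forall>\<^sub>F n in sequentially. A * (q\<^sup>2) ^ n < e' / 3 \<and> H * q ^ n / (1 - q) < e' / 3 \<and> n0 \<le> n"
        by eventually_elim simp
      then obtain n where n: "A * (q\<^sup>2) ^ n < e' / 3" "H * q ^ n / (1 - q) < e' / 3" "n0 \<le> n"
        by (auto simp: eventually_sequentially)
      define S where "S z = (\<Sum>m<n. f m z)" for z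
      have "isCont (f m) (g t)" for m
      proof -
        have "open (- P m)" using P(1)[of m] by (auto intro: finite_imp_closed)
        moreover have "continuous_on (- P m) (f m)" using f_hol[of m] by (rule holomorphic_on_imp_continuous_on)
        ultimately show ?thesis using tP[of m] by (auto simp: continuous_on_eq_continuous_at)
      qed
      then have "isCont S (g t)" unfolding S_def by (intro continuous_intros)
      then have "((\<lambda>s. Re (cnj (\<nu> t) * S (p s))) \<longlongrightarrow> Re (cnj (\<nu> t) * S (g t))) (at_left 1)"
        by (intro tendsto_intros isCont_tendsto_compose[OF _ p_lim])
      then have ev1: "\<forall>\<^sub>F s in at_left 1. dist (Re (cnj (\<nu> t) * S (p s))) (Re (cnj (\<nu> t) * S (g t))) < e' / 3"
        using e' by (intro tendstoD) auto
      have ev2: "\<forall>\<^sub>F s in at_left 1. dist (p s) (g t) < r1" using p_lim c1(2) by (rule tendstoD)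
      have ev3: "\<forall>\<^sub>F s in at_left 1. s \<in> {0<..<1::real}" by (rule eventually_at_left_real) simp
      show "\<forall>\<^sub>F s in at_left 1. dist (Re (cnj (\<nu> t) * F (p s))) (r t) < e'"
        using ev1 ev2 ev3 in_sector
      proof eventually_elim
        case (elim s)
        have "p s \<in> D" using p_D elim(3) by auto
        moreover have "cmod (p s - g t) < r1" using elim(2) by (simp only: dist_norm)
        ultimately have "cmod (F (p s) - S (p s)) \<le> H * q ^ n / (1 - q)"
          unfolding S_def using elim(4) by (intro tail[OF n(3)])
        with n(2) have "cmod (F (p s) - S (p s)) < e' / 3" by linarith
        moreover have "\<bar>Re (cnj (\<nu> t) * (F (p s) - S (p s)))\<bar> \<le> cmod (F (p s) - S (p s))"
          using abs_Re_le_cmod[of "cnj (\<nu> t) * (F (p s) - S (p s))"] unit[OF t01] by (simp add: norm_mult)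
        moreover have "Re (cnj (\<nu> t) * (F (p s) - S (p s))) = Re (cnj (\<nu> t) * F (p s)) - Re (cnj (\<nu> t) * S (p s))"
          by (simp add: algebra_simps)
        moreover have "Re (cnj (\<nu> t) * S (g t)) = r t - R n t" using R_sum[of n] by (simp add: S_def)
        moreover have "\<bar>R n t\<bar> < e' / 3" using A(2)[OF n(3)] n(1) by simp
        ultimately show ?case using elim(1) unfolding dist_real_def by linarith
      qed
    qed
  qed
  have AE_B: "AE t in lebesgue. \<forall>\<^sub>F n in sequentially. t \<notin> B n"
  proof -
    have "AE t in lebesgue. \<forall>\<^sub>F n in sequentially. t \<in> space lebesgue - B n"
    proof (rule borel_cantelli_AE1)
      show "B n \<in> sets lebesgue" for n using B(1)[of n] by auto
      show "emeasure lebesgue (B n) < \<infinity>" for n using B(1)[of n] by (auto simp: fmeasurable_def)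
      show "summable (\<lambda>n. measure lebesgue (B n))"
        using B(2) by (intro summable_comparison_test[OF _ kappa_summable]) auto
    qed
    then show ?thesis by simp
  qed
  \<comment> \<open>There are countably many poles in all and \<open>g\<close> is injective on the
    open interval, so the parameters that hit one form a null set.\<close>
  have AE_P: "AE t in lebesgue. t \<in> {0<..<1} \<longrightarrow> (\<forall>n. g t \<notin> P n)"
  proof -
    have "inj_on g {0<..<1}" using interior_param_unique by (auto simp: inj_on_def)
    then have "finite (g -` P n \<inter> {0<..<1})" for n using P(1)[of n] by (intro finite_vimage_IntI)
    then have "negligible (\<Union>n. g -` P n \<inter> {0<..<1})"
      by (intro negligible_countable_Union) (auto intro: negligible_finite)
    then have "AE t in lebesgue. t \<notin> (\<Union>n. g -` P n \<inter> {0<..<1})"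
      by (intro AE_not_in) (simp add: negligible_iff_null_sets)
    then show ?thesis by eventually_elim auto
  qed
  have "AE t in lebesgue. t \<in> {0..1} \<longrightarrow> (\<forall>v. regular t v \<longrightarrow> (\<forall>p. nontangential_path D (g t) v p \<longrightarrow>
       ((\<lambda>s. Re (cnj (\<nu> t) * F (p s))) \<longlongrightarrow> r t) (at_left 1)))"
    using AE_B AE_P
  proof eventually_elim
    case (elim t)
    show ?case
    proof (intro impI allI)
      fix v p assume reg: "regular t v" and p: "nontangential_path D (g t) v p"
      have "g t \<notin> P n" for n using elim(2) regularD(1,2)[OF reg] by simp
      then show "((\<lambda>s. Re (cnj (\<nu> t) * F (p s))) \<longlongrightarrow> r t) (at_left 1)"
        by (rule conv[OF reg p elim(1)])
    qed
  qed
  moreover have "{0..1::real} \<inter> space lebesgue \<in> sets lebesgue" by simp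
  ultimately have "AE t in lebesgue_on {0..1}. \<forall>v. regular t v \<longrightarrow> (\<forall>p. nontangential_path D (g t) v p \<longrightarrow>
       ((\<lambda>s. Re (cnj (\<nu> t) * F (p s))) \<longlongrightarrow> r t) (at_left 1))"
    by (simp only: AE_restrict_space_iff)
  with F_hol F_K show thesis by (rule that)
qed

text \<open>Solve the problem with a function small on \<open>K\<close> for the data left over by
  \<open>P\<close>, then add \<open>P\<close>. Being continuous on the plane, \<open>P\<close>
  contributes its boundary value along every path.\<close>

lemma bv_class_dense:
  assumes lam: "\<forall>\<zeta>\<in>path_image g. cmod (lam \<zeta>) = 1"
    and meas: "(\<lambda>t. lam (g t)) \<in> borel_measurable (lebesgue_on {0..1})"
      "(\<lambda>t. phi (g t)) \<in> borel_measurable (lebesgue_on {0..1})"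
    and P: "P holomorphic_on UNIV" and K: "compact K" "K \<subseteq> D" and e: "0 < \<epsilon>"
  obtains f where "f \<in> bv_class D g lam phi" "\<And>z. z \<in> K \<Longrightarrow> cmod (f z - P z) \<le> \<epsilon>"
proof -
  define r where "r t = phi (g t) - Re (cnj (lam (g t)) * P (g t))" for t
  have P_cont: "continuous_on UNIV P" using P by (rule holomorphic_on_imp_continuous_on)
  have "g \<in> borel_measurable (lebesgue_on {0..1})"
    by (intro continuous_imp_measurable_on_sets_lebesgue continuous_g) auto
  then have Pg: "(\<lambda>t. P (g t)) \<in> borel_measurable (lebesgue_on {0..1})"
    by (rule measurable_compose) (rule borel_measurable_continuous_onI[OF P_cont])
  have cnj_meas: "(\<lambda>t. cnj (lam (g t))) \<in> borel_measurable (lebesgue_on {0..1})"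
    by (rule measurable_compose[OF meas(1)]) (intro borel_measurable_continuous_onI continuous_intros)
  have "(\<lambda>t. Re (cnj (lam (g t)) * P (g t))) \<in> borel_measurable (lebesgue_on {0..1})"
    by (rule measurable_compose[OF borel_measurable_times[OF cnj_meas Pg]])
      (intro borel_measurable_continuous_onI continuous_intros)
  then have r_meas: "r \<in> borel_measurable (lebesgue_on {0..1})"
    unfolding r_def using meas(2) by (intro borel_measurable_diff)
  have unit: "cmod (lam (g t)) = 1" if "t \<in> {0..1}" for t using lam in_path_image[OF that] by blast
  obtain F where F: "F holomorphic_on D" "\<And>z. z \<in> K \<Longrightarrow> cmod (F z) \<le> \<epsilon>"
    "AE t in lebesgue_on {0..1}. \<forall>v. regular t v \<longrightarrow> (\<forall>p. nontangential_path D (g t) v p \<longrightarrow>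
       ((\<lambda>s. Re (cnj (lam (g t)) * F (p s))) \<longlongrightarrow> r t) (at_left 1))"
    by (rule boundary_problem_small_solution[OF unit r_meas meas(1) K e]) (assumption, rule that)
  have "AE t in lebesgue. t \<notin> {0, 1::real}"
    by (intro AE_not_in) (simp add: negligible_iff_null_sets[symmetric] negligible_finite)
  then have "AE t in lebesgue_on {0..1}. t \<in> {0<..<1::real}"
    by (subst AE_restrict_space_iff) (auto elim: eventually_mono)
  with F(3) have "AE t in lebesgue_on {0..1}.
      \<forall>v. (g has_vector_derivative v) (at t) \<and> v \<noteq> 0 \<longrightarrow>
        (\<forall>p. nontangential_path D (g t) v p \<longrightarrow>
           ((\<lambda>s. Re (cnj (lam (g t)) * (P (p s) + F (p s)))) \<longlongrightarrow> phi (g t)) (at_left 1))"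
  proof eventually_elim
    case (elim t)
    show ?case
    proof (intro allI impI)
      fix v p assume v: "(g has_vector_derivative v) (at t) \<and> v \<noteq> 0" and p: "nontangential_path D (g t) v p"
      have "regular t v" using v elim(2) by (auto simp: regular_def)
      with elim(1) p have "((\<lambda>s. Re (cnj (lam (g t)) * F (p s))) \<longlongrightarrow> r t) (at_left 1)" by blast
      moreover have "((\<lambda>s. P (p s)) \<longlongrightarrow> P (g t)) (at_left 1)"
        using p P_cont unfolding nontangential_path_def
        by (intro isCont_tendsto_compose[of "g t" P]) (auto simp: continuous_on_eq_continuous_at)
      ultimately have "((\<lambda>s. Re (cnj (lam (g t)) * P (p s)) + Re (cnj (lam (g t)) * F (p s))) \<longlongrightarrow>
          Re (cnj (lam (g t)) * P (g t)) + r t) (at_left 1)"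
        by (intro tendsto_intros)
      moreover have "Re (cnj (lam (g t)) * P (p s)) + Re (cnj (lam (g t)) * F (p s)) =
          Re (cnj (lam (g t)) * (P (p s) + F (p s)))" for s
        by (simp add: algebra_simps)
      moreover have "Re (cnj (lam (g t)) * P (g t)) + r t = phi (g t)" by (simp add: r_def)
      ultimately show "((\<lambda>s. Re (cnj (lam (g t)) * (P (p s) + F (p s)))) \<longlongrightarrow> phi (g t)) (at_left 1)"
        by (simp only:)
    qed
  qed
  moreover have "(\<lambda>z. P z + F z) holomorphic_on D"
    using holomorphic_on_subset[OF P] F(1) by (intro holomorphic_intros) auto
  ultimately have "(\<lambda>z. P z + F z) \<in> bv_class D g lam phi" by (simp add: bv_class_def)
  then show thesis by (rule that) (simp add: F(2))
qed

end

section \<open>Infinite dimension\<close>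

lemma lagrange_basis:
  fixes z :: "nat \<Rightarrow> complex"
  assumes "inj_on z {..<n}" "i < n"
  obtains P where "P holomorphic_on UNIV" "\<And>j. j < n \<Longrightarrow> P (z j) = (if j = i then 1 else 0)"
proof (rule that[of "\<lambda>w. \<Prod>k\<in>{..<n} - {i}. (w - z k) / (z i - z k)"])
  have ne: "z i - z k \<noteq> 0" if "k \<in> {..<n} - {i}" for k
    using assms that by (auto simp: inj_on_def)
  then show "(\<lambda>w. \<Prod>k\<in>{..<n} - {i}. (w - z k) / (z i - z k)) holomorphic_on UNIV"
    by (intro holomorphic_intros) auto
  show "(\<Prod>k\<in>{..<n} - {i}. (z j - z k) / (z i - z k)) = (if j = i then 1 else 0)" if "j < n" for j
    using ne that by (auto intro!: prod.neutral)
qed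

text \<open>Read the relation at an index where \<open>\<bar>c j\<bar>\<close> is largest: the
  deviation from the identity matrix accounts for at most \<open>real n * \<epsilon>\<close> times
  that maximum, which forces it to vanish.\<close>

lemma diagonally_dominant_kernel:
  fixes c :: "nat \<Rightarrow> real" and m :: "nat \<Rightarrow> nat \<Rightarrow> complex"
  assumes zero: "\<And>j. j < n \<Longrightarrow> (\<Sum>i<n. complex_of_real (c i) * m i j) = 0"
    and near: "\<And>i j. i < n \<Longrightarrow> j < n \<Longrightarrow> cmod (m i j - (if j = i then 1 else 0)) \<le> \<epsilon>"
    and e: "0 \<le> \<epsilon>" "real n * \<epsilon> < 1" and i: "i < n"
  shows "c i = 0"
proof -
  obtain j where j: "j < n" "\<And>k. k < n \<Longrightarrow> \<bar>c k\<bar> \<le> \<bar>c j\<bar>"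
  proof -
    have "Max ((\<lambda>k. \<bar>c k\<bar>) ` {..<n}) \<in> (\<lambda>k. \<bar>c k\<bar>) ` {..<n}" using i by (intro Max_in) auto
    then obtain j where "j < n" "Max ((\<lambda>k. \<bar>c k\<bar>) ` {..<n}) = \<bar>c j\<bar>" by auto
    then show thesis using that[of j] by (metis Max_ge finite_imageI finite_lessThan imageI lessThan_iff)
  qed
  have "(\<Sum>k<n. complex_of_real (c k) * (if j = k then 1 else 0)) = complex_of_real (c j)"
    using j(1) by (simp add: if_distrib cong: if_cong)
  then have "complex_of_real (c j) = - (\<Sum>k<n. complex_of_real (c k) * (m k j - (if j = k then 1 else 0)))"
    using zero[OF j(1)] by (simp only: right_diff_distrib sum_subtractf) simp
  then have "\<bar>c j\<bar> = cmod (\<Sum>k<n. complex_of_real (c k) * (m k j - (if j = k then 1 else 0)))"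
    by (metis norm_minus_cancel norm_of_real)
  also have "\<dots> \<le> (\<Sum>k<n. \<bar>c j\<bar> * \<epsilon>)"
  proof (rule sum_norm_le)
    fix k assume "k \<in> {..<n}"
    then show "cmod (complex_of_real (c k) * (m k j - (if j = k then 1 else 0))) \<le> \<bar>c j\<bar> * \<epsilon>"
      unfolding norm_mult norm_of_real using near[of k j] j by (intro mult_mono) auto
  qed
  also have "\<dots> = \<bar>c j\<bar> * (real n * \<epsilon>)" by simp
  finally have "\<bar>c j\<bar> * (1 - real n * \<epsilon>) \<le> 0" by (simp add: algebra_simps)
  then have "\<bar>c j\<bar> \<le> 0" using e by (simp add: mult_le_0_iff)
  then show ?thesis using j(2)[OF i] by simp
qed

theorem theorem5p2:
  fixes g :: "real \<Rightarrow> complex" and L :: real and D :: "complex set"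
    and lam :: "complex \<Rightarrow> complex" and phi :: "complex \<Rightarrow> real"
  assumes "simple_path g" and "pathfinish g = pathstart g"
    and "arclength_parametrized g L"
    and "D = inside (path_image g)"
    and "\<forall>\<zeta>\<in>path_image g. cmod (lam \<zeta>) = 1"
    and "(\<lambda>t. lam (g t)) \<in> borel_measurable (lebesgue_on {0..1})"
    and "(\<lambda>t. phi (g t)) \<in> borel_measurable (lebesgue_on {0..1})"
  shows "infinite_dim_differences D (bv_class D g lam phi)"
  unfolding infinite_dim_differences_def
proof
  fix n :: nat
  interpret lipschitz_loop g L
    using assms(1,2) arclength_parametrized_lipschitz[OF assms(3)] assms(3)
    by unfold_locales (auto simp: arclength_parametrized_def)
  have "open D" "D \<noteq> {}" unfolding assms(4) using open_D D_nonempty by auto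
  then have "infinite D" using finite_imp_not_open by blast
  then obtain Z where Z: "finite Z" "card Z = n" "Z \<subseteq> D" using infinite_arbitrarily_large by blast
  obtain z where z: "bij_betw z {0..<n} Z" using ex_bij_betw_nat_finite[OF Z(1)] Z(2) by auto
  have z_inj: "inj_on z {..<n}" and z_Z: "\<And>i. i < n \<Longrightarrow> z i \<in> Z"
    using z by (auto simp: bij_betw_def atLeast0LessThan)
  \<comment> \<open>A difference of two members reproduces a Lagrange basis function on
    \<open>Z\<close> up to \<open>2 * \<epsilon>\<close>, so
    \<open>real n * (2 * \<epsilon>)\<close> has to stay below 1.\<close>
  define \<epsilon> where "\<epsilon> = 1 / (4 * (real n + 1))"
  have e: "0 < \<epsilon>" "real n * (2 * \<epsilon>) < 1" by (auto simp: \<epsilon>_def field_simps)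
  have compact_Z: "compact Z" "Z \<subseteq> inside (path_image g)"
    using Z assms(4) by (auto intro: finite_imp_compact)
  note dense = bv_class_dense[OF assms(5-7) _ compact_Z e(1), folded assms(4)]
  \<comment> \<open>The common subtrahend, a base point of the affine class: it approximates the
    zero function on \<open>Z\<close>, so subtracting it hardly changes the values there.\<close>
  obtain f0 where f0: "f0 \<in> bv_class D g lam phi" "\<And>w. w \<in> Z \<Longrightarrow> cmod (f0 w) \<le> \<epsilon>"
    using dense[of "\<lambda>_. 0"] by auto
  have "\<exists>f. f \<in> bv_class D g lam phi \<and> (\<forall>j<n. cmod (f (z j) - (if j = i then 1 else 0)) \<le> \<epsilon>)" if i: "i < n" for i
  proof -
    obtain P where P: "P holomorphic_on UNIV" "\<And>j. j < n \<Longrightarrow> P (z j) = (if j = i then 1 else 0)"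
      using lagrange_basis[OF z_inj i] by metis
    obtain f where f: "f \<in> bv_class D g lam phi" "\<And>w. w \<in> Z \<Longrightarrow> cmod (f w - P w) \<le> \<epsilon>"
      using dense[OF P(1)] by blast
    have "cmod (f (z j) - (if j = i then 1 else 0)) \<le> \<epsilon>" if "j < n" for j
      using f(2)[OF z_Z[OF that]] P(2)[OF that] by (simp only:)
    with f(1) show ?thesis by blast
  qed
  then obtain f where f: "\<And>i. i < n \<Longrightarrow> f i \<in> bv_class D g lam phi"
    "\<And>i j. i < n \<Longrightarrow> j < n \<Longrightarrow> cmod (f i (z j) - (if j = i then 1 else 0)) \<le> \<epsilon>"
    by metis
  show "\<exists>h. (\<forall>i<n. \<exists>f1\<in>bv_class D g lam phi. \<exists>f2\<in>bv_class D g lam phi. \<forall>z\<in>D. h i z = f1 z - f2 z) \<and>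
      (\<forall>c. (\<forall>z\<in>D. (\<Sum>i<n. complex_of_real (c i) * h i z) = 0) \<longrightarrow> (\<forall>i<n. c i = 0))"
  proof (intro exI[of _ "\<lambda>i w. f i w - f0 w"] conjI allI impI)
    fix i assume "i < n"
    then show "\<exists>f1\<in>bv_class D g lam phi. \<exists>f2\<in>bv_class D g lam phi. \<forall>z\<in>D. f i z - f0 z = f1 z - f2 z"
      using f(1) f0(1) by blast
  next
    fix c :: "nat \<Rightarrow> real" and i
    assume zero: "\<forall>z\<in>D. (\<Sum>i<n. complex_of_real (c i) * (f i z - f0 z)) = 0" and i: "i < n"
    show "c i = 0"
    proof (rule diagonally_dominant_kernel[where m = "\<lambda>i j. f i (z j) - f0 (z j)" and \<epsilon> = "2 * \<epsilon>"])
      show "(\<Sum>i<n. complex_of_real (c i) * (f i (z j) - f0 (z j))) = 0" if "j < n" for j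
        using zero z_Z[OF that] Z(3) by blast
      show "cmod (f i (z j) - f0 (z j) - (if j = i then 1 else 0)) \<le> 2 * \<epsilon>" if "i < n" "j < n" for i j
      proof -
        have "f i (z j) - f0 (z j) - (if j = i then 1 else 0) = (f i (z j) - (if j = i then 1 else 0)) - f0 (z j)"
          by simp
        also have "cmod \<dots> \<le> cmod (f i (z j) - (if j = i then 1 else 0)) + cmod (f0 (z j))"
          by (rule norm_triangle_ineq4)
        also have "\<dots> \<le> 2 * \<epsilon>" using f(2)[OF that] f0(2)[OF z_Z[OF that(2)]] by simp
        finally show ?thesis .
      qed
    qed (use e i in auto)
  qed
qed

end
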